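(* Let $G$ be a finite abelian group of order $n \geq 2$. (1) If $n$ is even, then the maximum size of a $2$-incomplete subset of $G$ is $n/2$. Moreover, every element of $S(G,2)$ is of the form $n-n/d$ with $d$ an even divisor of $n$, and all such integers occur, with the only exception that $3n/4$ (the case $d=4$) occurs only when the exponent of $G$ is divisible by $4$. That is: if the exponent of $G$ is divisible by $4$, then $S(G,2)=\{n-n/d : d\mid n,\ 2\mid d\}$; if the exponent of $G$ is even but not divisible by $4$, then $S(G,2)=\{n-n/d : d\mid n,\ 2\mid d,\ d\neq 4\}$. (2) If $n$ is odd, then the maximum size of a $2$-incomplete subset of $G$ is $(n-1)/2$. Moreover, if $G$ is of order $3$, of order $5$, or is noncyclic of order $9$, then $S(G,2)=\{n-2\}$; for every other $G$ of odd order, $S(G,2)=\{n-2,n-1\}$.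
   Context: Let $G$ be a finite abelian group, written additively. For a positive integer $h$ and a nonempty subset $A\subseteq G$, $hA=\{a_1+\cdots+a_h : a_1,\dots,a_h\in A\}$ is the set of sums of $h$ not necessarily distinct elements of $A$. A nonempty subset $A$ is $h$-complete if $hA=G$ and $h$-incomplete if $hA\neq G$. The $h$-critical number is $\chi(G,h)=\min\{m\geq 1 : \text{every } A\subseteq G \text{ with } |A|\geq m \text{ satisfies } hA=G\}$; thus $\chi(G,h)-1$ is the maximum size of an $h$-incomplete subset. Define $S(G,h)=\{|hA| : A\subset G,\ |A|=\chi(G,h)-1,\ hA\neq G\}$, the set of sizes of $hA$ as $A$ ranges over the $h$-incomplete subsets of $G$ of maximum size. *)

theory Defs
  imports "HOL-Algebra.Algebra"
begin

text \<open>
  HOL-Algebra writes groups multiplicatively; thus the $h$-fold sumset $hA$ appears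
  below as the set of all $h$-fold products in the group operation.
\<close>

definition hfold :: "('a, 'b) monoid_scheme \<Rightarrow> nat \<Rightarrow> 'a set \<Rightarrow> 'a set" where
  "hfold G h A = {finprod G a {..<h} | a. a \<in> {..<h} \<rightarrow> A}"

definition incomplete :: "('a, 'b) monoid_scheme \<Rightarrow> nat \<Rightarrow> 'a set \<Rightarrow> bool" where
  "incomplete G h A \<longleftrightarrow> A \<subseteq> carrier G \<and> A \<noteq> {} \<and> hfold G h A \<noteq> carrier G"

definition critical_number :: "('a, 'b) monoid_scheme \<Rightarrow> nat \<Rightarrow> nat" where
  "critical_number G h =
     (LEAST m. 1 \<le> m \<and> (\<forall>A. A \<subseteq> carrier G \<and> m \<le> card A \<longrightarrow> hfold G h A = carrier G))"

definition incomplete_sizes :: "('a, 'b) monoid_scheme \<Rightarrow> nat \<Rightarrow> nat set" where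
  "incomplete_sizes G h =
     {card (hfold G h A) | A. incomplete G h A \<and> card A = critical_number G h - 1}"

definition group_exponent :: "('a, 'b) monoid_scheme \<Rightarrow> nat" where
  "group_exponent G = (LEAST e. 0 < e \<and> (\<forall>x\<in>carrier G. x [^]\<^bsub>G\<^esub> e = \<one>\<^bsub>G\<^esub>))"

end

theory Submission
  imports Defs
begin

text \<open>
  An element \<open>g\<close> lies outside \<open>AA\<close> iff \<open>A\<close> is disjoint from \<open>A\<^sup>-\<^sup>1g\<close>, so an incomplete set has at most
  \<open>n/2\<close> elements.

  If \<open>|A| = n/2\<close> and \<open>g \<notin> AA\<close>, then \<open>A\<^sup>-\<^sup>1g\<close> is the complement of \<open>A\<close>, and the complement of \<open>AA\<close> is
  the coset \<open>Hg\<close> of the stabilizer \<open>H\<close> of \<open>A\<close>. As \<open>A\<close> is a union of cosets of \<open>H\<close>, the index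
  \<open>d\<close> of \<open>H\<close> is even; for \<open>d = 4\<close>, \<open>A\<close> consists of two cosets, and \<open>|AA| = 3n/4\<close> forces a square
  outside \<open>H\<close>. Conversely, for subgroups \<open>H \<subseteq> M\<close> of index \<open>d\<close> and \<open>2\<close> and \<open>g \<notin> M\<close>, the set
  \<open>(M - H) \<union> Hg\<close> works if \<open>d \<ge> 6\<close>, and \<open>H \<union> Hx\<close> works if \<open>d = 4\<close> and \<open>x\<^sup>2 \<notin> H\<close>.

  If \<open>n\<close> is odd, every element is a square, so after a translation \<open>1 \<notin> AA\<close>, and then a maximal \<open>A\<close>
  contains exactly one of \<open>x\<close>, \<open>x\<^sup>-\<^sup>1\<close> for each \<open>x \<noteq> 1\<close>. Besides \<open>1\<close> at most one element is missing from
  \<open>AA\<close>, and it lies in \<open>A\<close>; so \<open>|AA| = n - 1\<close> iff \<open>A \<subseteq> AA\<close>. Whether such an \<open>A\<close> exists is decided by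
  explicit constructions according to whether \<open>G\<close> has an element of order at least 7 or
  has exponent 5 or 3.
\<close>

section \<open>Two-fold sumsets as set products, and the reduction to counting\<close>

lemma (in comm_group) hfold_2:
  assumes "A \<subseteq> carrier G"
  shows "hfold G 2 A = A <#> A"
proof
  have fp: "finprod G a {..<2::nat} = a 1 \<otimes> a 0" if "a \<in> {..<2::nat} \<rightarrow> carrier G" for a
  proof -
    have "{..<2::nat} = {1, 0}" by auto
    then show ?thesis using that by (simp add: Pi_iff)
  qed
  show "hfold G 2 A \<subseteq> A <#> A"
  proof
    fix x assume "x \<in> hfold G 2 A"
    then obtain a where a: "x = finprod G a {..<2}" "a \<in> {..<2::nat} \<rightarrow> A"
      unfolding hfold_def by auto
    then have "x = a 1 \<otimes> a 0" using fp[of a] assms by fastforce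
    moreover have "a 1 \<in> A" "a 0 \<in> A" using a(2) by auto
    ultimately show "x \<in> A <#> A" unfolding set_mult_def by blast
  qed
  show "A <#> A \<subseteq> hfold G 2 A"
  proof
    fix x assume "x \<in> A <#> A"
    then obtain y z where yz: "x = y \<otimes> z" "y \<in> A" "z \<in> A" unfolding set_mult_def by blast
    define a where "a = (\<lambda>i::nat. if i = 1 then y else z)"
    have "a \<in> {..<2} \<rightarrow> A" using yz unfolding a_def by auto
    moreover then have "finprod G a {..<2} = x" using fp[of a] assms yz unfolding a_def by fastforce
    ultimately show "x \<in> hfold G 2 A" unfolding hfold_def by blast
  qed
qed

locale finite_comm_group = comm_group +
  assumes finite_carrier: "finite (carrier G)"
begin

lemma l_inv_cancel [simp]:
  assumes "x \<in> carrier G" "y \<in> carrier G"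
  shows "inv x \<otimes> (x \<otimes> y) = y" "x \<otimes> (inv x \<otimes> y) = y"
  using assms by (simp_all flip: m_assoc)

lemma set_multI: "a \<in> A \<Longrightarrow> b \<in> B \<Longrightarrow> a \<otimes> b \<in> A <#> B"
  unfolding set_mult_def by blast

lemma set_multE:
  assumes "x \<in> A <#> B" obtains a b where "a \<in> A" "b \<in> B" "x = a \<otimes> b"
  using assms unfolding set_mult_def by blast

lemma not_in_set_mult_iff:
  assumes "A \<subseteq> carrier G" "g \<in> carrier G"
  shows "g \<notin> A <#> A \<longleftrightarrow> (\<forall>a\<in>A. inv a \<otimes> g \<notin> A)"
proof
  assume *: "g \<notin> A <#> A"
  show "\<forall>a\<in>A. inv a \<otimes> g \<notin> A"
  proof (intro ballI notI)
    fix a assume "a \<in> A" "inv a \<otimes> g \<in> A"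
    then have "a \<otimes> (inv a \<otimes> g) \<in> A <#> A" by (rule set_multI)
    with * \<open>a \<in> A\<close> assms show False by (simp add: subset_iff)
  qed
next
  assume *: "\<forall>a\<in>A. inv a \<otimes> g \<notin> A"
  show "g \<notin> A <#> A"
  proof
    assume "g \<in> A <#> A"
    then obtain a b where "a \<in> A" "b \<in> A" "g = a \<otimes> b" by (rule set_multE)
    with * assms show False by (auto simp: subset_iff)
  qed
qed

lemma finite_subset_carrier: "A \<subseteq> carrier G \<Longrightarrow> finite A"
  using finite_carrier finite_subset by blast

lemma card_reflect:
  assumes "A \<subseteq> carrier G" "g \<in> carrier G"
  shows "card ((\<lambda>a. inv a \<otimes> g) ` A) = card A"
proof (rule card_image, rule inj_onI)
  fix x y assume "x \<in> A" "y \<in> A" "inv x \<otimes> g = inv y \<otimes> g"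
  then show "x = y" using assms
    by (metis inv_closed inv_inv right_cancel subsetD)
qed

lemma card_incomplete:
  assumes "A \<subseteq> carrier G" "A <#> A \<noteq> carrier G"
  shows "2 * card A \<le> order G"
proof -
  obtain g where g: "g \<in> carrier G" "g \<notin> A <#> A"
    using assms set_mult_closed[OF assms(1) assms(1)] by blast
  let ?B = "(\<lambda>a. inv a \<otimes> g) ` A"
  have "A \<inter> ?B = {}" using not_in_set_mult_iff[OF assms(1) g(1)] g(2) by auto
  moreover have "A \<union> ?B \<subseteq> carrier G" using assms(1) g(1) by auto
  ultimately have "card A + card ?B \<le> card (carrier G)"
    by (metis card_Un_disjoint card_mono finite_carrier finite_subset le_sup_iff)
  then show ?thesis using card_reflect[OF assms(1) g(1)] by (simp add: order_def)
qed

text \<open>By commutativity the two translating factors collect to \<open>t \<otimes> t\<close>. A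
  missing element that is a square can therefore be moved to \<open>\<one>\<close>.\<close>

lemma set_mult_translate:
  assumes "A \<subseteq> carrier G" "t \<in> carrier G"
  shows "((\<otimes>) t ` A) <#> ((\<otimes>) t ` A) = (\<otimes>) (t \<otimes> t) ` (A <#> A)"
proof -
  have "(t \<otimes> a) \<otimes> (t \<otimes> b) = (t \<otimes> t) \<otimes> (a \<otimes> b)" if "a \<in> A" "b \<in> A" for a b
    using that assms by (simp add: subset_iff m_ac)
  then show ?thesis
    unfolding set_mult_def by (auto simp: image_iff)
qed

lemma card_translate:
  assumes "A \<subseteq> carrier G" "t \<in> carrier G"
  shows "card ((\<otimes>) t ` A) = card A"
  using assms by (auto intro!: card_image inj_onI simp: subset_iff)

text \<open>A bound together with one set attaining it determines both the maximum and the critical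
  number, so the later counting deals only with \<open>A <#> A\<close>. The hypothesis
  \<open>1 \<le> N\<close> makes sets of size \<open>N\<close> nonempty, as
  \<open>incomplete\<close> demands.\<close>

lemma maximum_incomplete:
  assumes "1 \<le> N"
    and le: "\<And>A. A \<subseteq> carrier G \<Longrightarrow> A <#> A \<noteq> carrier G \<Longrightarrow> card A \<le> N"
    and B: "B \<subseteq> carrier G" "B <#> B \<noteq> carrier G" "card B = N"
  shows "Max {card A | A. incomplete G 2 A} = N"
    and "incomplete_sizes G 2 =
      {card (A <#> A) | A. A \<subseteq> carrier G \<and> A <#> A \<noteq> carrier G \<and> card A = N}"
proof -
  have inc: "incomplete G 2 A \<longleftrightarrow> A \<subseteq> carrier G \<and> A \<noteq> {} \<and> A <#> A \<noteq> carrier G" for A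
    unfolding incomplete_def using hfold_2 by auto
  have Bne: "B \<noteq> {}" using B(3) assms(1) by auto
  show "Max {card A | A. incomplete G 2 A} = N"
  proof (rule Max_eqI)
    have "{card A | A. incomplete G 2 A} \<subseteq> {..N}" using le inc by auto
    then show "finite {card A | A. incomplete G 2 A}" using finite_subset by blast
    show "N \<in> {card A | A. incomplete G 2 A}" using B Bne inc by auto
  qed (use le inc in auto)
  \<comment> \<open>\<open>N + 1\<close> is the least size that forces completeness:
    \<open>B\<close> rules out every threshold up to \<open>N\<close>.\<close>
  have "critical_number G 2 = N + 1"
    unfolding critical_number_def
  proof (rule Least_equality)
    have "hfold G 2 A = carrier G" if "A \<subseteq> carrier G" "N + 1 \<le> card A" for A
      using le[OF that(1)] that hfold_2 by fastforce
    then show "1 \<le> N + 1 \<and> (\<forall>A. A \<subseteq> carrier G \<and> N + 1 \<le> card A \<longrightarrow> hfold G 2 A = carrier G)"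
      by simp
    fix m assume m: "1 \<le> m \<and> (\<forall>A. A \<subseteq> carrier G \<and> m \<le> card A \<longrightarrow> hfold G 2 A = carrier G)"
    then have "\<not> m \<le> card B" using B hfold_2[OF B(1)] by auto
    then show "N + 1 \<le> m" using B(3) by simp
  qed
  then have "incomplete_sizes G 2 = {card (hfold G 2 A) | A. incomplete G 2 A \<and> card A = N}"
    unfolding incomplete_sizes_def by simp
  also have "\<dots> = {card (A <#> A) | A. A \<subseteq> carrier G \<and> A <#> A \<noteq> carrier G \<and> card A = N}"
  proof -
    have "incomplete G 2 A \<and> card A = N \<longleftrightarrow> A \<subseteq> carrier G \<and> A <#> A \<noteq> carrier G \<and> card A = N" for A
      using inc assms(1) by auto
    then show ?thesis using hfold_2 by (metis (no_types, lifting))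
  qed
  finally show "incomplete_sizes G 2 =
      {card (A <#> A) | A. A \<subseteq> carrier G \<and> A <#> A \<noteq> carrier G \<and> card A = N}" .
qed

section \<open>Groups of odd order\<close>

text \<open>For odd order \<open>n\<close> the exponent \<open>(n + 1) / 2\<close> is an integer,
  and doubling it gives \<open>c [^] (n + 1) = c\<close>.\<close>

lemma square_root:
  assumes "odd (order G)" "c \<in> carrier G"
  shows "(c [^] (Suc (order G) div 2)) \<otimes> (c [^] (Suc (order G) div 2)) = c"
proof -
  have "Suc (order G) div 2 + Suc (order G) div 2 = Suc (order G)" using assms(1) by presburger
  then show ?thesis using assms(2) pow_order_eq_1[of c] by (simp add: nat_pow_mult)
qed

lemma subgroup_nat_pow:
  assumes "subgroup K G" "x \<in> K"
  shows "x [^] (m::nat) \<in> K"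
  using assms by (induction m) (auto simp: subgroup.one_closed subgroup.m_closed)

text \<open>In odd order \<open>x\<close> is a power of its own square.\<close>

lemma square_mem_subgroup_iff:
  assumes "odd (order G)" "subgroup K G" "x \<in> carrier G"
  shows "x \<otimes> x \<in> K \<longleftrightarrow> x \<in> K"
proof
  let ?m = "Suc (order G) div 2"
  assume "x \<otimes> x \<in> K"
  then have "(x \<otimes> x) [^] ?m \<in> K"
    by (rule subgroup_nat_pow[OF assms(2)])
  moreover have "(x \<otimes> x) [^] ?m = x"
    using square_root[OF assms(1,3)] assms(3) by (simp add: pow_mult_distrib m_comm)
  ultimately show "x \<in> K" by simp
qed (use assms(2) in \<open>simp add: subgroup.m_closed\<close>)

section \<open>Half systems: one element from each pair of inverses\<close>

text \<open>The normal form of a maximum incomplete set in odd order, after a translation that makes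
  \<open>\<one>\<close> a missing product. The equivalence leaves no room for
  \<open>x = inv x\<close> with \<open>x \<noteq> \<one>\<close>.\<close>

definition half_system :: "'a set \<Rightarrow> bool" where
  "half_system A \<longleftrightarrow> A \<subseteq> carrier G \<and> \<one> \<notin> A \<and>
     (\<forall>x\<in>carrier G. x \<noteq> \<one> \<longrightarrow> (inv x \<in> A \<longleftrightarrow> x \<notin> A))"

lemma half_systemD:
  assumes "half_system A"
  shows "A \<subseteq> carrier G" "\<one> \<notin> A" "x \<in> A \<Longrightarrow> inv x \<notin> A"
    "x \<in> carrier G \<Longrightarrow> x \<noteq> \<one> \<Longrightarrow> x \<notin> A \<Longrightarrow> inv x \<in> A"
  using assms unfolding half_system_def by (blast | metis subsetD)+

lemma half_system_card:
  assumes "half_system A"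
  shows "2 * card A = order G - 1"
proof -
  note h = half_systemD[OF assms]
  have "inj_on (m_inv G) A" using h(1) by (meson inj_on_subset inv_inj)
  then have "card (m_inv G ` A) = card A" by (rule card_image)
  moreover have "m_inv G ` A \<inter> A = {}" using h(3) by auto
  moreover have "m_inv G ` A \<union> A = carrier G - {\<one>}"
  proof
    show "m_inv G ` A \<union> A \<subseteq> carrier G - {\<one>}" using h(1,2) by (auto simp: subset_iff)
    show "carrier G - {\<one>} \<subseteq> m_inv G ` A \<union> A"
    proof
      fix x assume x: "x \<in> carrier G - {\<one>}"
      show "x \<in> m_inv G ` A \<union> A"
      proof (cases "x \<in> A")
        case False
        then have "inv x \<in> A" using h(4) x by auto
        then have "inv (inv x) \<in> m_inv G ` A" by (rule imageI)
        then show ?thesis using x by simp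
      qed simp
    qed
  qed
  moreover have "card (m_inv G ` A \<union> A) = card (m_inv G ` A) + card A"
    using calculation(2) h(1) finite_subset_carrier by (intro card_Un_disjoint) auto
  ultimately show ?thesis using finite_carrier by (simp add: order_def)
qed

text \<open>The missing product \<open>\<one>\<close> makes \<open>A\<close> disjoint from its set
  of inverses; the size then forces the two together to exhaust the nontrivial elements.\<close>

lemma half_systemI:
  assumes "A \<subseteq> carrier G" "\<one> \<notin> A <#> A" "2 * card A = order G - 1"
  shows "half_system A"
proof -
  have inv: "inv a \<notin> A" if "a \<in> A" for a
    using not_in_set_mult_iff[OF assms(1) one_closed] assms(1,2) that by (auto simp: subset_iff)
  have one: "\<one> \<notin> A" using inv[of \<one>] by auto
  have "inj_on (m_inv G) A" using assms(1) by (meson inj_on_subset inv_inj)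
  then have "card (m_inv G ` A) = card A" by (rule card_image)
  moreover have "m_inv G ` A \<inter> A = {}" using inv by auto
  then have "card (m_inv G ` A \<union> A) = card (m_inv G ` A) + card A"
    using assms(1) finite_subset_carrier by (intro card_Un_disjoint) auto
  moreover have sub: "m_inv G ` A \<union> A \<subseteq> carrier G - {\<one>}" using assms(1) one by (auto simp: subset_iff)
  moreover have "card (carrier G - {\<one>}) = order G - 1" by (simp add: order_def)
  ultimately have eq: "m_inv G ` A \<union> A = carrier G - {\<one>}"
    using assms(3) by (intro card_subset_eq) (use finite_carrier in auto)
  have "inv x \<in> A" if x: "x \<in> carrier G" "x \<noteq> \<one>" "x \<notin> A" for x
  proof -
    from x eq have "x \<in> m_inv G ` A" by blast
    then obtain a where "a \<in> A" "x = inv a" by blast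
    then show ?thesis using assms(1) by auto
  qed
  then show ?thesis unfolding half_system_def using assms(1) one inv
    by (metis (no_types, lifting))
qed

lemma half_system_one_notin:
  assumes "half_system A" shows "\<one> \<notin> A <#> A"
  using half_systemD[OF assms] not_in_set_mult_iff[of A \<one>] by (auto simp: subset_iff)

lemma m_middle:
  assumes "a \<in> carrier G" "b \<in> carrier G" "c \<in> carrier G" "d \<in> carrier G"
  shows "(a \<otimes> b) \<otimes> (c \<otimes> d) = (a \<otimes> c) \<otimes> (b \<otimes> d)"
  using assms by (simp add: m_ac)

lemma subgroup_mult_mem_iff:
  assumes "subgroup K G" "k \<in> K" "x \<in> carrier G"
  shows "k \<otimes> x \<in> K \<longleftrightarrow> x \<in> K" "x \<otimes> k \<in> K \<longleftrightarrow> x \<in> K"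
proof -
  have k: "k \<in> carrier G" using assms(1,2) by (rule subgroup.mem_carrier)
  have "x \<in> K" if "k \<otimes> x \<in> K"
  proof -
    have "inv k \<otimes> (k \<otimes> x) \<in> K"
      using assms(1,2) that by (simp add: subgroup.m_closed subgroup.m_inv_closed)
    then show ?thesis using k assms(3) by simp
  qed
  then show "k \<otimes> x \<in> K \<longleftrightarrow> x \<in> K" using assms by (auto simp: subgroup.m_closed)
  then show "x \<otimes> k \<in> K \<longleftrightarrow> x \<in> K" using k assms(3) by (simp add: m_comm)
qed

lemma subgroup_inv_mem_iff:
  assumes "subgroup K G" "x \<in> carrier G"
  shows "inv x \<in> K \<longleftrightarrow> x \<in> K"
  using assms by (metis inv_inv subgroup.m_inv_closed)

section \<open>Half systems made of cosets outside a subgroup\<close>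

text \<open>For a subgroup \<open>K\<close>, invariance under multiplication describes the unions of
  cosets without indexing them.\<close>

definition coset_union :: "'a set \<Rightarrow> 'a set \<Rightarrow> bool" where
  "coset_union K W \<longleftrightarrow> W \<subseteq> carrier G \<and> (\<forall>k\<in>K. \<forall>w\<in>W. k \<otimes> w \<in> W)"

lemma coset_unionD:
  assumes "coset_union K W" "k \<in> K" "w \<in> W"
  shows "k \<otimes> w \<in> W"
  using assms unfolding coset_union_def by blast

lemma coset_union_r_coset:
  assumes "subgroup K G" "x \<in> carrier G"
  shows "coset_union K (K #> x)"
  unfolding coset_union_def
proof (intro conjI ballI)
  show "K #> x \<subseteq> carrier G" using assms by (simp add: r_coset_subset_G subgroup.subset)
  fix k w assume "k \<in> K" "w \<in> K #> x"
  then obtain k' where "k' \<in> K" "w = k' \<otimes> x" unfolding r_coset_def by auto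
  then have "k \<otimes> w = (k \<otimes> k') \<otimes> x" "k \<otimes> k' \<in> K"
    using assms \<open>k \<in> K\<close> by (auto simp: m_assoc subgroup.m_closed subgroup.mem_carrier)
  then show "k \<otimes> w \<in> K #> x" unfolding r_coset_def by auto
qed

lemma coset_union_Un: "coset_union K V \<Longrightarrow> coset_union K W \<Longrightarrow> coset_union K (V \<union> W)"
  unfolding coset_union_def by blast

lemma mem_r_coset_iff:
  assumes "subgroup K G" "x \<in> carrier G" "y \<in> carrier G"
  shows "y \<in> K #> x \<longleftrightarrow> y \<otimes> inv x \<in> K"
proof
  assume "y \<in> K #> x"
  then obtain k where "k \<in> K" "y = k \<otimes> x" unfolding r_coset_def by auto
  then show "y \<otimes> inv x \<in> K" using assms by (simp add: m_assoc subgroup.mem_carrier)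
next
  assume "y \<otimes> inv x \<in> K"
  moreover have "y = (y \<otimes> inv x) \<otimes> x" using assms by (simp add: m_assoc)
  ultimately show "y \<in> K #> x" unfolding r_coset_def by blast
qed

text \<open>For a subgroup \<open>K\<close>, this is the preimage of a half system of the quotient
  by \<open>K\<close>.\<close>

definition half_outside :: "'a set \<Rightarrow> 'a set \<Rightarrow> bool" where
  "half_outside K W \<longleftrightarrow> coset_union K W \<and> W \<inter> K = {} \<and>
     (\<forall>x\<in>carrier G - K. inv x \<in> W \<longleftrightarrow> x \<notin> W)"

text \<open>A maximal admissible extension \<open>W\<close> of \<open>U\<close> works: if neither
  \<open>x\<close> nor \<open>inv x\<close> belonged to it, the whole coset \<open>K #> x\<close>
  could be added. Odd order prevents that coset from being its own inverse.\<close>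

lemma ex_half_outside:
  assumes odd: "odd (order G)" and K: "subgroup K G"
    and U: "coset_union K U" "U \<inter> K = {}" "\<And>u. u \<in> U \<Longrightarrow> inv u \<notin> U"
  shows "\<exists>W. U \<subseteq> W \<and> half_outside K W"
proof -
  define F where "F = {W. U \<subseteq> W \<and> coset_union K W \<and> W \<inter> K = {} \<and> (\<forall>x\<in>W. inv x \<notin> W)}"
  have "F \<subseteq> Pow (carrier G)" unfolding F_def coset_union_def by blast
  then have "finite F" using finite_carrier by (meson finite_Pow_iff finite_subset)
  moreover have "U \<in> F" unfolding F_def using U by blast
  ultimately obtain W where W: "W \<in> F" and max: "\<And>V. V \<in> F \<Longrightarrow> W \<subseteq> V \<Longrightarrow> V = W"
    using finite_has_maximal[of F] by blast
  have Wp: "U \<subseteq> W" "coset_union K W" "W \<inter> K = {}" "\<And>x. x \<in> W \<Longrightarrow> inv x \<notin> W"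
    using W unfolding F_def by auto
  have WG: "W \<subseteq> carrier G" using Wp(2) unfolding coset_union_def by blast
  have "inv x \<in> W" if x: "x \<in> carrier G" "x \<notin> K" "x \<notin> W" for x
  proof (rule ccontr)
    assume nx: "inv x \<notin> W"
    let ?V = "W \<union> (K #> x)"
    have cu: "coset_union K ?V" using coset_union_Un[OF Wp(2) coset_union_r_coset[OF K x(1)]] .
    have dis: "?V \<inter> K = {}"
    proof -
      have "k \<otimes> x \<notin> K" if "k \<in> K" for k using subgroup_mult_mem_iff(1)[OF K that x(1)] x(2) by simp
      then show ?thesis using Wp(3) unfolding r_coset_def by auto
    qed
    have sep: "inv y \<notin> W" if yK: "y \<in> K #> x" for y
    proof
      assume y: "inv y \<in> W"
      obtain k where k: "k \<in> K" "y = k \<otimes> x" using yK unfolding r_coset_def by auto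
      have "k \<otimes> inv y \<in> W" using coset_unionD[OF Wp(2) k(1) y] .
      moreover have "k \<otimes> inv y = inv x" using k x(1) K by (simp add: inv_mult subgroup.mem_carrier)
      ultimately show False using nx by simp
    qed
    have "inv y \<notin> ?V" if y: "y \<in> ?V" for y
    proof
      assume iy: "inv y \<in> ?V"
      have yG: "y \<in> carrier G" using y cu unfolding coset_union_def by blast
      consider "y \<in> W" "inv y \<in> W" | "y \<in> W" "inv y \<in> K #> x" | "y \<in> K #> x" "inv y \<in> W"
        | "y \<in> K #> x" "inv y \<in> K #> x" using y iy by blast
      then show False
      proof cases
        case 2 then show False using sep[of "inv y"] yG by simp
      next
        case 4
        \<comment> \<open>Multiplying the two memberships cancels \<open>y\<close> and leaves the
          square of \<open>inv x\<close> in \<open>K\<close>; odd order then puts \<open>x\<close>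
          in \<open>K\<close>.\<close>
        have "y \<otimes> inv x \<in> K" "inv y \<otimes> inv x \<in> K"
          using 4 mem_r_coset_iff[OF K x(1)] yG by auto
        then have "(y \<otimes> inv x) \<otimes> (inv y \<otimes> inv x) \<in> K" by (rule subgroup.m_closed[OF K])
        moreover have "(y \<otimes> inv x) \<otimes> (inv y \<otimes> inv x) = inv x \<otimes> inv x"
          by (subst m_middle) (use x(1) yG in auto)
        ultimately have "inv x \<in> K" using square_mem_subgroup_iff[OF odd K, of "inv x"] x(1) by simp
        then show False using subgroup_inv_mem_iff[OF K x(1)] x(2) by simp
      qed (use Wp sep in auto)
    qed
    then have "?V \<in> F" unfolding F_def using cu dis Wp(1) by blast
    then have "?V = W" using max by blast
    moreover have "x \<in> K #> x" using rcos_self[OF x(1) K] .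
    ultimately show False using x(3) by blast
  qed
  then have "half_outside K W" unfolding half_outside_def using Wp WG by blast
  then show ?thesis using Wp(1) by blast
qed

text \<open>A half system of \<open>K\<close> and one pulled back from the quotient combine, since
  inversion preserves both \<open>K\<close> and its complement.\<close>

lemma half_system_Un:
  assumes K: "subgroup K G" and W: "half_outside K W"
    and P: "P \<subseteq> K" "\<one> \<notin> P" "\<And>x. x \<in> K \<Longrightarrow> x \<noteq> \<one> \<Longrightarrow> inv x \<in> P \<longleftrightarrow> x \<notin> P"
  shows "half_system (P \<union> W)"
proof -
  have KG: "K \<subseteq> carrier G" using K by (rule subgroup.subset)
  have WG: "W \<subseteq> carrier G" "W \<inter> K = {}" "\<And>x. x \<in> carrier G \<Longrightarrow> x \<notin> K \<Longrightarrow> inv x \<in> W \<longleftrightarrow> x \<notin> W"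
    using W unfolding half_outside_def coset_union_def by auto
  have "inv x \<in> P \<union> W \<longleftrightarrow> x \<notin> P \<union> W" if x: "x \<in> carrier G" "x \<noteq> \<one>" for x
  proof (cases "x \<in> K")
    case True
    then have "inv x \<in> K" using subgroup_inv_mem_iff[OF K x(1)] by simp
    then show ?thesis using P(3)[OF True x(2)] True WG(2) by blast
  next
    case False
    then have "inv x \<notin> K" using subgroup_inv_mem_iff[OF K x(1)] by simp
    then show ?thesis using WG(3)[OF x(1) False] False P(1) by blast
  qed
  then show ?thesis unfolding half_system_def
    using P KG WG(1,2) subgroup.one_closed[OF K] by blast
qed

text \<open>If \<open>y\<close> is missing but \<open>inv y \<in> A\<close>, then every power of \<open>inv y\<close> lies in \<open>A\<close>, including \<open>\<one>\<close>.\<close>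

lemma half_system_missing:
  assumes "odd (order G)" and A: "half_system A" and y: "y \<in> carrier G" "y \<noteq> \<one>" "y \<notin> A <#> A"
  shows "y \<in> A"
proof (rule ccontr)
  assume "y \<notin> A"
  note h = half_systemD[OF A]
  have iy: "inv y \<in> A" using h(4)[OF y(1,2)] \<open>y \<notin> A\<close> by simp
  have av: "inv a \<otimes> y \<notin> A" if "a \<in> A" for a
    using not_in_set_mult_iff[OF h(1) y(1)] y(3) that by blast
  have "inv y [^] Suc k \<in> A" for k :: nat
  proof (induction k)
    case 0
    then show ?case using iy y(1) by simp
  next
    case (Suc k)
    let ?b = "inv y [^] Suc k"
    have b: "?b \<in> carrier G" using y(1) by simp
    \<comment> \<open>\<open>inv ?b \<otimes> y\<close> is the partner that \<open>?b\<close> would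
      need to produce \<open>y\<close>. It is not in \<open>A\<close>, so its inverse, the next
      power of \<open>inv y\<close>, is; this requires it to be nontrivial.\<close>
    have "inv ?b \<otimes> y \<noteq> \<one>"
    proof
      assume *: "inv ?b \<otimes> y = \<one>"
      have "y = ?b \<otimes> (inv ?b \<otimes> y)" using b y(1) by (simp del: nat_pow_Suc)
      also have "\<dots> = ?b" using * b by (simp del: nat_pow_Suc)
      finally have "y = ?b" .
      then show False using Suc \<open>y \<notin> A\<close> by simp
    qed
    moreover have "inv ?b \<otimes> y \<notin> A" using av[OF Suc] .
    ultimately have "inv (inv ?b \<otimes> y) \<in> A" using h(4)[of "inv ?b \<otimes> y"] b y(1) by (simp del: nat_pow_Suc)
    moreover have "inv (inv ?b \<otimes> y) = inv y [^] Suc (Suc k)"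
      using b y(1) by (simp add: inv_mult)
    ultimately show ?case by simp
  qed
  \<comment> \<open>The induction runs over exponents \<open>Suc k\<close>, so this index yields the
    power \<open>order G\<close>, which is \<open>\<one>\<close>.\<close>
  from this[of "order G - 1"] have "inv y [^] order G \<in> A"
    using finite_carrier order_gt_0_iff_finite by (simp del: nat_pow_Suc)
  then show False using pow_order_eq_1[of "inv y"] y(1) h(2) by simp
qed

text \<open>Both elements would lie in \<open>A\<close>, so neither \<open>inv z \<otimes> y\<close>
  nor \<open>inv y \<otimes> z\<close> does. These are nontrivial and mutually inverse, so one of
  them must.\<close>

lemma half_system_missing_unique:
  assumes "odd (order G)" and A: "half_system A"
    and y: "y \<in> carrier G" "y \<noteq> \<one>" "y \<notin> A <#> A"
    and z: "z \<in> carrier G" "z \<noteq> \<one>" "z \<notin> A <#> A"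
  shows "y = z"
proof (rule ccontr)
  assume "y \<noteq> z"
  note h = half_systemD[OF A]
  have yA: "y \<in> A" and zA: "z \<in> A"
    using half_system_missing[OF assms(1) A] y z by auto
  have 1: "inv z \<otimes> y \<notin> A" using not_in_set_mult_iff[OF h(1) y(1)] y(3) zA by blast
  have 2: "inv y \<otimes> z \<notin> A" using not_in_set_mult_iff[OF h(1) z(1)] z(3) yA by blast
  have "inv (inv z \<otimes> y) = inv y \<otimes> z" using y(1) z(1) by (simp add: inv_mult m_comm)
  moreover have "inv z \<otimes> y \<noteq> \<one>" using \<open>y \<noteq> z\<close> y(1) z(1) by (metis inv_comm inv_equality inv_inv inv_closed)
  ultimately show False using 1 2 h(4)[of "inv z \<otimes> y"] y(1) z(1) by simp
qed

text \<open>The odd case thereby becomes the question which of \<open>A \<subseteq> A <#> A\<close>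
  and its negation half systems can satisfy.\<close>

lemma half_system_sumset_card:
  assumes "odd (order G)" and A: "half_system A"
  shows "card (A <#> A) = (if A \<subseteq> A <#> A then order G - 1 else order G - 2)"
proof -
  note h = half_systemD[OF A]
  have sub: "A <#> A \<subseteq> carrier G" using set_mult_closed[OF h(1) h(1)] .
  have one: "\<one> \<notin> A <#> A" using half_system_one_notin[OF A] .
  show ?thesis
  proof (cases "A \<subseteq> A <#> A")
    case True
    have "A <#> A = carrier G - {\<one>}"
      using sub one half_system_missing[OF assms] True by blast
    then show ?thesis using True by (simp add: order_def)
  next
    case False
    then obtain y where y: "y \<in> A" "y \<notin> A <#> A" by blast
    have "y \<noteq> \<one>" using y h(2) by blast
    have yG: "y \<in> carrier G" using y h(1) by blast
    have "A <#> A = carrier G - {\<one>, y}"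
      using sub one y yG half_system_missing_unique[OF assms yG \<open>y \<noteq> \<one>\<close> y(2)] by blast
    moreover have "card (carrier G - {\<one>, y}) = order G - 2"
      using \<open>y \<noteq> \<one>\<close> yG by (subst card_Diff_subset) (auto simp: order_def)
    ultimately show ?thesis using False by simp
  qed
qed

section \<open>Half systems built over a cyclic subgroup\<close>

lemma subgroup_generate1: "g \<in> carrier G \<Longrightarrow> subgroup (generate G {g}) G"
  by (rule generate_is_subgroup) simp

lemma generate_pow_cases:
  assumes "g \<in> carrier G" "x \<in> generate G {g}"
  obtains i where "0 \<le> i" "i < int (ord g)" "x = g [^] i"
proof -
  obtain k :: int where k: "x = g [^] k" using assms generate_pow by blast
  have pos: "0 < int (ord g)" using ord_ge_1[OF finite_carrier assms(1)] by simp
  have "int (ord g) dvd k mod int (ord g) - k" by (simp flip: mod_eq_dvd_iff)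
  then have "x = g [^] (k mod int (ord g))"
    using k int_pow_eq[OF assms(1), of k "k mod int (ord g)"] by simp
  then show ?thesis using that[of "k mod int (ord g)"] pos by simp
qed

lemma int_pow_eq_bounded:
  assumes "g \<in> carrier G" "0 \<le> i" "i < int (ord g)" "0 \<le> j" "j < int (ord g)" "g [^] i = g [^] j"
  shows "i = j"
proof -
  have "int (ord g) dvd j - i" "int (ord g) dvd i - j"
    using assms int_pow_eq by metis+
  then show ?thesis
    using assms(2-5) zdvd_not_zless[of "j - i" "int (ord g)"] zdvd_not_zless[of "i - j" "int (ord g)"]
    by linarith
qed

text \<open>Inversion in the cyclic subgroup sends the exponent \<open>i\<close> to
  \<open>ord g - i\<close>, so a choice of exponents \<open>J\<close> gives a half system there.
  Integer exponents let differences be treated as congruences modulo \<open>ord g\<close>.\<close>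

lemma half_system_cyclic_Un:
  assumes g: "g \<in> carrier G" and W: "half_outside (generate G {g}) W"
    and J: "J \<subseteq> {1..<int (ord g)}" "\<And>i. i \<in> {1..<int (ord g)} \<Longrightarrow> int (ord g) - i \<in> J \<longleftrightarrow> i \<notin> J"
  shows "half_system ((\<lambda>i::int. g [^] i) ` J \<union> W)"
proof (rule half_system_Un[OF subgroup_generate1[OF g] W])
  let ?P = "(\<lambda>i::int. g [^] i) ` J"
  have mem: "g [^] i \<in> ?P \<longleftrightarrow> i \<in> J" if "0 \<le> i" "i < int (ord g)" for i
  proof
    assume "g [^] i \<in> ?P"
    then obtain j where "j \<in> J" "g [^] i = g [^] j" by blast
    moreover then have "0 \<le> j" "j < int (ord g)" using J(1) by (auto dest!: subsetD)
    ultimately show "i \<in> J" using int_pow_eq_bounded[OF g that] by blast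
  qed simp
  show "?P \<subseteq> generate G {g}" using generate_pow[OF g] by blast
  have pos: "0 < int (ord g)" using ord_ge_1[OF finite_carrier g] by simp
  have "0 \<notin> J" using J(1) by auto
  then show "\<one> \<notin> ?P" using mem[of 0] pos by simp
  fix x assume x: "x \<in> generate G {g}" "x \<noteq> \<one>"
  obtain i where i: "0 \<le> i" "i < int (ord g)" "x = g [^] i" using generate_pow_cases[OF g x(1)] .
  have "i \<noteq> 0" using i x by auto
  have "int (ord g) dvd (int (ord g) - i) - (- i)" by simp
  then have "inv x = g [^] (int (ord g) - i)"
    using i int_pow_eq[OF g, of "- i" "int (ord g) - i"] by (simp add: int_pow_neg g)
  then show "inv x \<in> ?P \<longleftrightarrow> x \<notin> ?P"
    using J(2)[of i] i \<open>i \<noteq> 0\<close> mem[of i] mem[of "int (ord g) - i"] by simp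
qed

lemma odd_ord: "odd (order G) \<Longrightarrow> g \<in> carrier G \<Longrightarrow> odd (ord g)"
  using ord_dvd_group_order dvd_trans by blast

text \<open>The element lies in the coset of \<open>inv w\<close>, which is neither \<open>K\<close>
  nor part of \<open>W\<close>. Hence no element of \<open>K\<close> is a product of an element of
  \<open>W\<close> with one of \<open>K \<union> W\<close>.\<close>

lemma half_outside_inv_closed:
  assumes K: "subgroup K G" and W: "half_outside K W" and "k \<in> K" "w \<in> W"
  shows "inv w \<otimes> k \<notin> W" "inv w \<otimes> k \<notin> K"
proof -
  have cu: "coset_union K W" and dis: "W \<inter> K = {}"
    and inv: "\<And>x. x \<in> carrier G - K \<Longrightarrow> inv x \<in> W \<longleftrightarrow> x \<notin> W"
    using W unfolding half_outside_def by auto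
  have c: "w \<in> carrier G" "k \<in> carrier G"
    using assms(3,4) cu subgroup.mem_carrier[OF K] unfolding coset_union_def by auto
  have "w \<notin> K" using dis assms(4) by blast
  then have iK: "inv w \<notin> K" using subgroup_inv_mem_iff[OF K c(1)] by simp
  then show "inv w \<otimes> k \<notin> K" using subgroup_mult_mem_iff(2)[OF K assms(3)] c by simp
  show "inv w \<otimes> k \<notin> W"
  proof
    assume "inv w \<otimes> k \<in> W"
    then have "inv k \<otimes> (inv w \<otimes> k) \<in> W"
      using coset_unionD[OF cu] subgroup.m_inv_closed[OF K assms(3)] by blast
    then have "inv w \<in> W" using c by (simp add: m_comm[of "inv w" k])
    then show False using inv[of w] c \<open>w \<notin> K\<close> assms(4) by simp
  qed
qed

text \<open>With \<open>ord g = 2 * m + 1\<close>, take the exponents from \<open>1\<close> to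
  \<open>m\<close>. Two of them add up to a value between \<open>2\<close> and \<open>2 * m\<close>,
  never congruent to \<open>1\<close>, and products with a factor from \<open>W\<close> miss the
  subgroup; so \<open>g\<close> is missing.\<close>

lemma ex_half_system_not_covered:
  assumes odd: "odd (order G)" and g: "g \<in> carrier G" "g \<noteq> \<one>"
  shows "\<exists>A. half_system A \<and> \<not> A \<subseteq> A <#> A"
proof -
  let ?K = "generate G {g}"
  have K: "subgroup ?K G" using subgroup_generate1[OF g(1)] .
  obtain m where m: "ord g = 2 * m + 1" using odd_ord[OF odd g(1)] oddE by blast
  have m1: "m \<ge> 1" using ord_eq_1[OF g(1)] g(2) m by (cases m) auto
  have "coset_union ?K {}" unfolding coset_union_def by simp
  then obtain W where W: "half_outside ?K W" using ex_half_outside[OF odd K, of "{}"] by auto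
  define P where "P = (\<lambda>i::int. g [^] i) ` {1..int m}"
  have A: "half_system (P \<union> W)" unfolding P_def
    by (rule half_system_cyclic_Un[OF g(1) W]) (use m in auto)
  note h = half_systemD[OF A]
  have gP: "g \<in> P" unfolding P_def using m1 g by (auto intro!: image_eqI[of _ _ 1] simp: int_pow_1)
  have PK: "P \<subseteq> ?K" unfolding P_def using generate_pow[OF g(1)] by blast
  have gK: "g \<in> ?K" using PK gP by blast
  have WG: "W \<subseteq> carrier G" "W \<inter> ?K = {}"
    using W unfolding half_outside_def coset_union_def by auto
  have "g \<notin> (P \<union> W) <#> (P \<union> W)"
    unfolding not_in_set_mult_iff[OF h(1) g(1)]
  proof
    fix a assume a: "a \<in> P \<union> W"
    show "inv a \<otimes> g \<notin> P \<union> W"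
    proof (cases "a \<in> W")
      case True
      then show ?thesis using half_outside_inv_closed[OF K W gK True] PK by blast
    next
      case False
      then have "a \<in> P" using a by blast
      then obtain i where i: "1 \<le> i" "i \<le> int m" "a = g [^] i" unfolding P_def by auto
      have e: "inv a \<otimes> g = g [^] (1 - i)"
        using i g(1) by (simp add: int_pow_diff m_comm)
      have "inv a \<otimes> g \<in> ?K" using e generate_pow[OF g(1)] by blast
      then have nW: "inv a \<otimes> g \<notin> W" using WG(2) by blast
      have "inv a \<otimes> g \<notin> P"
      proof
        assume "inv a \<otimes> g \<in> P"
        then obtain j where j: "1 \<le> j" "j \<le> int m" "g [^] (1 - i) = g [^] j" unfolding P_def e by auto
        then have "int (ord g) dvd j - (1 - i)" using int_pow_eq[OF g(1)] by blast
        moreover have "0 < j - (1 - i)" "j - (1 - i) < int (ord g)" using i j m by auto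
        ultimately show False using zdvd_not_zless by blast
      qed
      then show ?thesis using nW by blast
    qed
  qed
  then show ?thesis using A gP by blast
qed

lemma half_system_swap:
  assumes "half_system A" "u \<in> A"
  shows "half_system (insert (inv u) (A - {u}))"
proof -
  note h = half_systemD[OF assms(1)]
  have u: "u \<in> carrier G" "u \<noteq> \<one>" using h assms(2) by auto
  have iu: "inv u \<notin> A" using h(3) assms(2) .
  have "inv x \<in> insert (inv u) (A - {u}) \<longleftrightarrow> x \<notin> insert (inv u) (A - {u})"
    if x: "x \<in> carrier G" "x \<noteq> \<one>" for x
  proof -
    have "inv x \<in> A \<longleftrightarrow> x \<notin> A" using assms(1) x unfolding half_system_def by blast
    moreover have "inv x = u \<longleftrightarrow> x = inv u" "inv x = inv u \<longleftrightarrow> x = u"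
      using x u by (metis inv_inv)+
    ultimately show ?thesis using iu assms(2) by (cases "x = u"; cases "x = inv u") simp_all
  qed
  moreover have "inv u \<noteq> \<one>" using u by (metis inv_inv inv_one)
  then have "\<one> \<notin> insert (inv u) (A - {u})" using h(2) by simp
  moreover have "insert (inv u) (A - {u}) \<subseteq> carrier G" using h(1) u(1) by auto
  ultimately show ?thesis unfolding half_system_def by simp
qed

text \<open>Exchanging \<open>u\<close> for its inverse makes every \<open>p \<in> P\<close> a product, \<open>p = inv u \<otimes> (u \<otimes> p)\<close>, while
  the elements of \<open>W\<close> other than \<open>u \<otimes> d\<close> remain products with the factor \<open>d\<close>.\<close>

lemma half_system_swap_covered:
  assumes K: "subgroup K G" and W: "half_outside K W" and P: "P \<subseteq> K" "\<one> \<notin> P" "d \<in> P"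
    and u: "u \<in> W" and A: "A = insert (inv u) ((P \<union> W) - {u})"
    and ud: "u \<otimes> d \<in> A <#> A" and iu: "inv u \<in> A <#> A"
  shows "A \<subseteq> A <#> A"
proof
  have cu: "coset_union K W" and dis: "W \<inter> K = {}" using W unfolding half_outside_def by auto
  have WG: "W \<subseteq> carrier G" using cu unfolding coset_union_def by auto
  have KG: "K \<subseteq> carrier G" using K by (rule subgroup.subset)
  have uG: "u \<in> carrier G" using WG u by blast
  have up: "u \<otimes> p \<in> A" if "p \<in> P" for p
  proof -
    have "p \<in> carrier G" "p \<noteq> \<one>" "p \<in> K" using that P KG by auto
    then have "u \<otimes> p \<in> W" "u \<otimes> p \<noteq> u" using coset_unionD[OF cu _ u] uG m_comm by auto
    then show ?thesis unfolding A by blast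
  qed
  fix a assume "a \<in> A"
  then consider "a = inv u" | "a \<in> P" | "a \<in> W" "a \<noteq> u" unfolding A by blast
  then show "a \<in> A <#> A"
  proof cases
    case 1 then show ?thesis using iu by simp
  next
    case 2
    then have "inv u \<otimes> (u \<otimes> a) \<in> A <#> A" using up by (intro set_multI) (auto simp: A)
    then show ?thesis using 2 P(1) KG uG by (simp add: subset_iff)
  next
    case 3
    have dG: "d \<in> carrier G" "d \<in> K" using P KG by auto
    have aG: "a \<in> carrier G" using 3 WG by blast
    show ?thesis
    proof (cases "a = u \<otimes> d")
      case True then show ?thesis using ud by simp
    next
      case False
      have "inv d \<otimes> a \<in> W" using coset_unionD[OF cu _ 3(1)] subgroup.m_inv_closed[OF K dG(2)] by blast
      moreover have "inv d \<otimes> a \<noteq> u"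
      proof
        assume "inv d \<otimes> a = u"
        then have "d \<otimes> (inv d \<otimes> a) = u \<otimes> d" using dG uG by (simp add: m_comm)
        then show False using False dG aG by simp
      qed
      ultimately have "inv d \<otimes> a \<in> A" unfolding A by blast
      moreover have "d \<in> A" using P dis u unfolding A by blast
      ultimately have "d \<otimes> (inv d \<otimes> a) \<in> A <#> A" by (intro set_multI)
      then show ?thesis using dG aG by simp
    qed
  qed
qed

text \<open>Multiplying the two memberships cancels \<open>z\<close> and leaves
  \<open>inv (x \<otimes> y)\<close> in \<open>K\<close>. This serves to check that a proposed union
  of cosets contains no two mutually inverse elements.\<close>

lemma inv_notin_r_coset:
  assumes K: "subgroup K G" and c: "x \<in> carrier G" "y \<in> carrier G" and "x \<otimes> y \<notin> K" "z \<in> K #> x"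
  shows "inv z \<notin> K #> y"
proof
  assume *: "inv z \<in> K #> y"
  have zG: "z \<in> carrier G" using assms r_coset_subset_G subgroup.subset by blast
  have "z \<otimes> inv x \<in> K" "inv z \<otimes> inv y \<in> K"
    using * assms(5) mem_r_coset_iff[OF K] c zG by auto
  then have "(z \<otimes> inv x) \<otimes> (inv z \<otimes> inv y) \<in> K" by (rule subgroup.m_closed[OF K])
  moreover have "(z \<otimes> inv x) \<otimes> (inv z \<otimes> inv y) = inv (x \<otimes> y)"
    by (subst m_middle) (use c zG in \<open>auto simp: inv_mult\<close>)
  ultimately show False using assms(4) subgroup_inv_mem_iff[OF K, of "x \<otimes> y"] c by simp
qed

text \<open>In the interval of exponents from \<open>1\<close> to \<open>m\<close>, the exponent
  \<open>m\<close> is replaced by its negative \<open>m + 1\<close>, so that \<open>1\<close>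
  becomes a sum. Elements of \<open>W\<close> are covered with the factor \<open>g\<close>, because
  \<open>W\<close> is invariant under the subgroup.\<close>

lemma ex_covered_of_large_ord:
  assumes odd: "odd (order G)" and g: "g \<in> carrier G" "ord g \<ge> 7"
  shows "\<exists>A. half_system A \<and> A \<subseteq> A <#> A"
proof -
  let ?K = "generate G {g}"
  have K: "subgroup ?K G" using subgroup_generate1[OF g(1)] .
  obtain m where m: "ord g = 2 * m + 1" using odd_ord[OF odd g(1)] oddE by blast
  have m3: "m \<ge> 3" using g(2) m by simp
  have "coset_union ?K {}" unfolding coset_union_def by simp
  then obtain W where W: "half_outside ?K W" using ex_half_outside[OF odd K, of "{}"] by auto
  \<comment> \<open>\<open>1 \<equiv> 2 (m + 1)\<close> and \<open>m + 1 = 2 + (m - 1)\<close> modulo \<open>2 m + 1\<close>; the latter needs \<open>m \<ge> 3\<close>.\<close>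
  define J where "J = insert (int m + 1) {1..int m - 1}"
  define A where "A = (\<lambda>i::int. g [^] i) ` J \<union> W"
  have half: "half_system A" unfolding A_def
    by (rule half_system_cyclic_Un[OF g(1) W]) (use m m3 in \<open>auto simp: J_def\<close>)
  have J: "g [^] (i + j) \<in> A <#> A" if "i \<in> J" "j \<in> J" for i j
    using that g(1) set_multI[of "g [^] i" A "g [^] j" A] unfolding A_def by (simp add: int_pow_mult)
  have "A \<subseteq> A <#> A"
  proof
    fix a assume "a \<in> A"
    then consider "a \<in> W" | i where "a = g [^] i" "i \<in> J" unfolding A_def by blast
    then show "a \<in> A <#> A"
    proof cases
      case 1
      have cu: "coset_union ?K W" using W unfolding half_outside_def by auto
      have "g \<in> ?K" by (rule generate.incl) simp
      then have "inv g \<otimes> a \<in> W" using coset_unionD[OF cu _ 1] subgroup.m_inv_closed[OF K] by blast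
      moreover have "g \<in> A" unfolding A_def J_def using m3 g(1) by (auto intro!: image_eqI[of _ _ 1] simp: int_pow_1)
      ultimately have "g \<otimes> (inv g \<otimes> a) \<in> A <#> A" by (intro set_multI) (auto simp: A_def)
      moreover have "a \<in> carrier G" using 1 cu unfolding coset_union_def by auto
      ultimately show ?thesis using g(1) by simp
    next
      case 2
      consider "i = 1" | "2 \<le> i" "i \<le> int m - 1" | "i = int m + 1"
        using 2(2) unfolding J_def by fastforce
      then show ?thesis
      proof cases
        case 1
        have "int (ord g) dvd ((int m + 1) + (int m + 1)) - 1" using m by simp
        then have "a = g [^] ((int m + 1) + (int m + 1))"
          using 2 1 int_pow_eq[OF g(1), of 1 "(int m + 1) + (int m + 1)"] by simp
        then show ?thesis using J[of "int m + 1" "int m + 1"] unfolding J_def by simp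
      next
        case i: 2
        then show ?thesis using 2 J[of 1 "i - 1"] unfolding J_def by simp
      next
        case 3
        then show ?thesis using 2 J[of 2 "int m - 1"] m3 unfolding J_def by (simp add: add.commute)
      qed
    qed
  qed
  then show ?thesis using half by blast
qed

lemma card_r_coset:
  assumes "subgroup K G" "x \<in> carrier G"
  shows "card (K #> x) = card K"
  using card_rcosets_equal[of "K #> x" K] rcosetsI[of K x] subgroup.subset[OF assms(1)] assms(2) by simp

lemma nat_pow_numeral_simps:
  assumes "x \<in> carrier G"
  shows "x [^] (2::nat) = x \<otimes> x" "x [^] (3::nat) = x \<otimes> (x \<otimes> x)"
    "x [^] (5::nat) = x \<otimes> (x \<otimes> (x \<otimes> (x \<otimes> x)))"
  using assms by (simp_all add: numeral_eq_Suc m_assoc)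

text \<open>Over a subgroup of order 5 with representatives \<open>d\<close> and
  \<open>d \<otimes> d\<close>, an outside element \<open>u\<close> is exchanged for its inverse.
  The product \<open>u \<otimes> d\<close> is recovered as
  \<open>(d \<otimes> d) \<otimes> (inv d \<otimes> u)\<close>, which does not use
  \<open>u\<close>.\<close>

lemma ex_covered_of_exponent_5:
  assumes odd: "odd (order G)" and exp: "\<And>x. x \<in> carrier G \<Longrightarrow> x [^] (5::nat) = \<one>"
    and n: "order G > 5" 
  shows "\<exists>A. half_system A \<and> A \<subseteq> A <#> A"
proof -
  have e5: "x \<otimes> (x \<otimes> (x \<otimes> (x \<otimes> x))) = \<one>" if "x \<in> carrier G" for x
    using exp[OF that] nat_pow_numeral_simps[OF that] by simp
  have "carrier G \<noteq> {\<one>}" using n by (auto simp: order_def)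
  then obtain d where d: "d \<in> carrier G" "d \<noteq> \<one>" using one_closed by blast
  let ?K = "generate G {d}"
  have K: "subgroup ?K G" using subgroup_generate1[OF d(1)] .
  have "Factorial_Ring.prime (5::nat)" by simp
  moreover have "ord d dvd 5" using exp[OF d(1)] pow_eq_id[OF d(1)] by simp
  ultimately have od: "ord d = 5" using ord_eq_1[OF d(1)] d(2) by (meson prime_nat_iff)
  then have "card ?K < order G" using n generate_pow_card[OF d(1)] by simp
  then have "?K \<noteq> carrier G" by (auto simp: order_def)
  then obtain u where u: "u \<in> carrier G" "u \<notin> ?K" using subgroup.subset[OF K] by blast
  have u2: "u \<otimes> u \<notin> ?K" using square_mem_subgroup_iff[OF odd K u(1)] u(2) by simp
  have u4: "(u \<otimes> u) \<otimes> (u \<otimes> u) \<notin> ?K" using square_mem_subgroup_iff[OF odd K, of "u \<otimes> u"] u(1) u2 by simp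
  have u3: "u \<otimes> (u \<otimes> u) \<notin> ?K"
  proof
    assume "u \<otimes> (u \<otimes> u) \<in> ?K"
    moreover have "(u \<otimes> (u \<otimes> u)) \<otimes> (u \<otimes> u) = \<one>" using e5[OF u(1)] u(1) by (simp add: m_ac)
    ultimately have "u \<otimes> u \<in> ?K"
      using subgroup_mult_mem_iff(1)[OF K, of "u \<otimes> (u \<otimes> u)" "u \<otimes> u"] u(1) subgroup.one_closed[OF K] by simp
    then show False using u2 by simp
  qed
  \<comment> \<open>The coset of \<open>u \<otimes> u\<close> is included because \<open>inv u\<close> is the square of \<open>u \<otimes> u\<close>.\<close>
  define U where "U = (?K #> u) \<union> (?K #> (u \<otimes> u))"
  have "coset_union ?K U" unfolding U_def
    using coset_union_Un coset_union_r_coset[OF K] u(1) by simp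
  moreover have "U \<inter> ?K = {}"
    unfolding U_def r_coset_def using subgroup_mult_mem_iff(1)[OF K] u u2 by auto
  \<comment> \<open>Products of the two coset representatives are the second, third and fourth
    powers of \<open>u\<close>, all outside \<open>?K\<close>.\<close>
  moreover have "inv z \<notin> U" if zU: "z \<in> U" for z
    using zU u u2 u3 u4 inv_notin_r_coset[OF K, of u u z] inv_notin_r_coset[OF K, of u "u \<otimes> u" z]
      inv_notin_r_coset[OF K, of "u \<otimes> u" u z] inv_notin_r_coset[OF K, of "u \<otimes> u" "u \<otimes> u" z]
    unfolding U_def by (auto simp: m_assoc)
  ultimately obtain W where W: "U \<subseteq> W" "half_outside ?K W" using ex_half_outside[OF odd K] by blast
  define P where "P = (\<lambda>i::int. d [^] i) ` {1, 2}"
  have half: "half_system (P \<union> W)" unfolding P_def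
    by (rule half_system_cyclic_Un[OF d(1) W(2)]) (auto simp: od)
  have dP: "d \<in> P" unfolding P_def using d(1) by (simp add: int_pow_1)
  have d2P: "d \<otimes> d \<in> P"
    using int_pow_mult[OF d(1), of 1 1] d(1) unfolding P_def by (simp add: int_pow_1)
  have PK: "P \<subseteq> ?K" unfolding P_def using generate_pow[OF d(1)] by blast
  have oneP: "\<one> \<notin> P" using half half_systemD(2) by blast
  have cu: "coset_union ?K W" and dis: "W \<inter> ?K = {}" using W(2) unfolding half_outside_def by auto
  have uW: "u \<in> W" using W(1) rcos_self[OF u(1) K] unfolding U_def by blast
  have u2W: "u \<otimes> u \<in> W" using W(1) rcos_self[of "u \<otimes> u", OF _ K] u(1) unfolding U_def by blast
  define A where "A = insert (inv u) ((P \<union> W) - {u})"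
  have "u \<noteq> \<one>" using u(2) subgroup.one_closed[OF K] by blast
  then have "u \<otimes> u \<in> A" using u2W u(1) unfolding A_def by simp
  then have "(u \<otimes> u) \<otimes> (u \<otimes> u) \<in> A <#> A" by (intro set_multI)
  moreover have "inv u = (u \<otimes> u) \<otimes> (u \<otimes> u)"
    by (rule inv_equality) (use u(1) e5[OF u(1)] in \<open>simp_all add: m_assoc\<close>)
  ultimately have iu: "inv u \<in> A <#> A" by simp
  have "d \<in> ?K" using PK dP by blast
  then have "inv d \<otimes> u \<in> W" using coset_unionD[OF cu _ uW] subgroup.m_inv_closed[OF K] by blast
  moreover have "inv d \<otimes> u \<noteq> u" using d u(1) by (simp add: inv_eq_1_iff)
  ultimately have "inv d \<otimes> u \<in> A" unfolding A_def by blast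
  moreover have "d \<otimes> d \<in> A" using d2P PK dis uW unfolding A_def by blast
  ultimately have "(d \<otimes> d) \<otimes> (inv d \<otimes> u) \<in> A <#> A" by (intro set_multI)
  moreover have "(d \<otimes> d) \<otimes> (inv d \<otimes> u) = u \<otimes> d" using d(1) u(1) by (simp add: m_assoc m_comm[of u d])
  ultimately have ud: "u \<otimes> d \<in> A <#> A" by simp
  have "A \<subseteq> A <#> A"
    by (rule half_system_swap_covered[OF K W(2) PK oneP dP uW A_def ud iu])
  moreover have "half_system A" unfolding A_def using half_system_swap[OF half] uW by blast
  ultimately show ?thesis by blast
qed

text \<open>Over a subgroup of order 3 only \<open>d\<close> is available inside, so recovering
  \<open>u \<otimes> d\<close> after the exchange of \<open>u\<close> takes two auxiliary cosets,
  those of \<open>v\<close> and \<open>w\<close>. The inverse of \<open>u\<close> is its square,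
  written as \<open>(d \<otimes> u) \<otimes> (inv d \<otimes> u)\<close> since \<open>u\<close>
  itself has been removed.\<close>

lemma ex_covered_of_exponent_3:
  assumes odd: "odd (order G)" and exp: "\<And>x. x \<in> carrier G \<Longrightarrow> x [^] (3::nat) = \<one>"
    and n: "order G > 9"
  shows "\<exists>A. half_system A \<and> A \<subseteq> A <#> A"
proof -
  have e3: "x \<otimes> (x \<otimes> x) = \<one>" if "x \<in> carrier G" for x
    using exp[OF that] nat_pow_numeral_simps[OF that] by simp
  have sq: "x \<otimes> x = inv x" if "x \<in> carrier G" for x
    using e3[OF that] that by (intro inv_equality[symmetric]) (simp_all add: m_assoc)
  have "carrier G \<noteq> {\<one>}" using n by (auto simp: order_def)
  then obtain d where d: "d \<in> carrier G" "d \<noteq> \<one>" using one_closed by blast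
  let ?K = "generate G {d}"
  have K: "subgroup ?K G" using subgroup_generate1[OF d(1)] .
  have "Factorial_Ring.prime (3::nat)" by simp
  moreover have "ord d dvd 3" using exp[OF d(1)] pow_eq_id[OF d(1)] by simp
  ultimately have od: "ord d = 3" using ord_eq_1[OF d(1)] d(2) by (meson prime_nat_iff)
  then have cK: "card ?K = 3" using generate_pow_card[OF d(1)] by simp
  have "?K \<noteq> carrier G" using cK n by (auto simp: order_def)
  then obtain u where u: "u \<in> carrier G" "u \<notin> ?K" using subgroup.subset[OF K] by blast
  \<comment> \<open>Three cosets of a subgroup of order 3 hold at most 9 elements. Choosing
    \<open>v\<close> outside them keeps \<open>v \<otimes> inv u\<close> and
    \<open>v \<otimes> u\<close> outside \<open>?K\<close>.\<close>
  let ?V = "?K \<union> (?K #> u) \<union> (?K #> inv u)"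
  have "card ?V \<le> 9"
    using card_Un_le[of "?K \<union> (?K #> u)" "?K #> inv u"] card_Un_le[of ?K "?K #> u"]
      card_r_coset[OF K u(1)] card_r_coset[OF K, of "inv u"] u(1) cK by simp
  then have "?V \<noteq> carrier G" using n by (metis not_le order_def)
  moreover have "?V \<subseteq> carrier G" using K u(1) by (simp add: r_coset_subset_G subgroup.subset)
  ultimately obtain v where v: "v \<in> carrier G" "v \<notin> ?V" by blast
  have vK: "v \<notin> ?K" "v \<otimes> inv u \<notin> ?K" "v \<otimes> u \<notin> ?K"
    using v mem_r_coset_iff[OF K u(1) v(1)] mem_r_coset_iff[OF K _ v(1), of "inv u"] u(1) by auto
  define w where "w = u \<otimes> inv v"
  have wG: "w \<in> carrier G" unfolding w_def using u v by simp
  have iw: "inv w = v \<otimes> inv u" unfolding w_def using u v by (simp add: inv_mult m_comm)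
  have wK: "w \<notin> ?K" using vK(2) iw subgroup_inv_mem_iff[OF K wG] by simp
  have sqK: "x \<otimes> x \<notin> ?K" if "x \<in> carrier G" "x \<notin> ?K" for x
    using square_mem_subgroup_iff[OF odd K that(1)] that(2) by simp
  have uv: "u \<otimes> v \<notin> ?K" "v \<otimes> u \<notin> ?K" using vK(3) m_comm[OF u(1) v(1)] by auto
  have vw: "v \<otimes> w \<notin> ?K" "w \<otimes> v \<notin> ?K"
  proof -
    have "v \<otimes> w = u" unfolding w_def using u v by (simp add: m_comm[of u])
    then show "v \<otimes> w \<notin> ?K" using u by simp
    then show "w \<otimes> v \<notin> ?K" using m_comm[OF wG v(1)] by simp
  qed
  have uw: "u \<otimes> w \<notin> ?K" "w \<otimes> u \<notin> ?K"
  proof -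
    \<comment> \<open>The square of \<open>u\<close> is \<open>inv u\<close>, so
      \<open>u \<otimes> (u \<otimes> inv v)\<close> collapses to
      \<open>inv u \<otimes> inv v\<close>.\<close>
    have "u \<otimes> w = inv (u \<otimes> v)" unfolding w_def using u v sq[OF u(1)]
      by (simp add: inv_mult flip: m_assoc)
    then show "u \<otimes> w \<notin> ?K" using uv subgroup_inv_mem_iff[OF K, of "u \<otimes> v"] u v by simp
    then show "w \<otimes> u \<notin> ?K" using m_comm[OF wG u(1)] by simp
  qed
  \<comment> \<open>Chosen so that \<open>u \<otimes> d = v \<otimes> (d \<otimes> w)\<close> is a product of two elements of \<open>U\<close>.\<close>
  define U where "U = (?K #> u) \<union> (?K #> v) \<union> (?K #> w)"
  have "coset_union ?K U" unfolding U_def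
    using coset_union_Un coset_union_r_coset[OF K] u(1) v(1) wG by simp
  moreover have "U \<inter> ?K = {}"
    unfolding U_def r_coset_def using subgroup_mult_mem_iff(1)[OF K] u v(1) vK wG wK by auto
  moreover have "inv z \<notin> U" if z: "z \<in> U" for z
  proof -
    have *: "x \<otimes> y \<notin> ?K" "x \<in> carrier G" if "x \<in> {u, v, w}" "y \<in> {u, v, w}" for x y
      using that sqK u v(1) vK(1) wG wK uv vw uw by auto
    obtain x where x: "x \<in> {u, v, w}" "z \<in> ?K #> x" using z unfolding U_def by blast
    have "inv z \<notin> ?K #> y" if y: "y \<in> {u, v, w}" for y
      using inv_notin_r_coset[OF K _ _ _ x(2), of y] * x(1) y by blast
    then show ?thesis unfolding U_def by blast
  qed
  ultimately obtain W where W: "U \<subseteq> W" "half_outside ?K W" using ex_half_outside[OF odd K] by blast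
  define P where "P = (\<lambda>i::int. d [^] i) ` {1}"
  have half: "half_system (P \<union> W)" unfolding P_def
    by (rule half_system_cyclic_Un[OF d(1) W(2)]) (auto simp: od)
  have dP: "d \<in> P" unfolding P_def using d(1) by (simp add: int_pow_1)
  have PK: "P \<subseteq> ?K" unfolding P_def using generate_pow[OF d(1)] by blast
  have oneP: "\<one> \<notin> P" using half half_systemD(2) by blast
  have cu: "coset_union ?K W" and dis: "W \<inter> ?K = {}" using W(2) unfolding half_outside_def by auto
  have uW: "u \<in> W" and vW: "v \<in> W" and wW: "w \<in> W"
    using W(1) rcos_self[OF u(1) K] rcos_self[OF v(1) K] rcos_self[OF wG K] unfolding U_def by blast+
  define A where "A = insert (inv u) ((P \<union> W) - {u})"
  have dK: "d \<in> ?K" "inv d \<in> ?K" using PK dP subgroup.m_inv_closed[OF K] by auto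
  have "d \<otimes> u \<in> W" "inv d \<otimes> u \<in> W" using coset_unionD[OF cu _ uW] dK by auto
  moreover have "d \<otimes> u \<noteq> u" "inv d \<otimes> u \<noteq> u" using d u(1) by (simp_all add: inv_eq_1_iff)
  ultimately have "(d \<otimes> u) \<otimes> (inv d \<otimes> u) \<in> A <#> A" by (intro set_multI) (auto simp: A_def)
  moreover have "(d \<otimes> u) \<otimes> (inv d \<otimes> u) = inv u"
    by (subst m_middle) (use d u(1) sq[OF u(1)] in auto)
  ultimately have iu: "inv u \<in> A <#> A" by simp
  have "v \<noteq> u" using vK(2) u subgroup.one_closed[OF K] by auto
  then have vA: "v \<in> A" using vW unfolding A_def by blast
  have "d \<otimes> w \<in> W" using coset_unionD[OF cu dK(1) wW] .
  \<comment> \<open>Equality would force \<open>v = d\<close>; hence this factor survives the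
    removal of \<open>u\<close>.\<close>
  moreover have "d \<otimes> w \<noteq> u"
  proof
    assume "d \<otimes> w = u"
    then have "u \<otimes> (d \<otimes> inv v) = u" unfolding w_def using d u v by (simp add: m_lcomm)
    then have "d \<otimes> inv v = \<one>" using d u v by simp
    then have "inv (inv v) = d" using d v by (intro inv_equality) auto
    then have "v = d" using v(1) by simp
    then show False using vK(1) dK by simp
  qed
  ultimately have "d \<otimes> w \<in> A" unfolding A_def by blast
  then have "v \<otimes> (d \<otimes> w) \<in> A <#> A" using vA by (intro set_multI)
  moreover have "v \<otimes> (d \<otimes> w) = u \<otimes> d"
  proof -
    have "v \<otimes> (d \<otimes> w) = (v \<otimes> w) \<otimes> d" using d v wG by (simp add: m_ac)
    also have "v \<otimes> w = u" unfolding w_def using u v by (simp add: m_comm[of u])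
    finally show ?thesis .
  qed
  ultimately have ud: "u \<otimes> d \<in> A <#> A" by simp
  have "A \<subseteq> A <#> A"
    by (rule half_system_swap_covered[OF K W(2) PK oneP dP uW A_def ud iu])
  moreover have "half_system A" unfolding A_def using half_system_swap[OF half] uW by blast
  ultimately show ?thesis by blast
qed

section \<open>Odd-order groups with a half system covered by its products\<close>

lemma ord_eq_order_of_cyclic:
  assumes "cyclic_group G"
  obtains x where "x \<in> carrier G" "ord x = order G"
proof -
  obtain x where x: "x \<in> carrier G" "carrier G = range (\<lambda>n::int. x [^] n)"
    using assms cyclic_group by blast
  then have "generate G {x} = carrier G" using generate_pow[OF x(1)] by auto
  then show ?thesis using that x(1) generate_pow_card[OF x(1)] by (simp add: order_def)
qed

lemma cyclic_of_ord:
  assumes "x \<in> carrier G" "ord x = order G"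
  shows "cyclic_group G"
proof -
  have "generate G {x} = carrier G"
    using card_subset_eq[OF finite_carrier, of "generate G {x}"] generate_pow_card[OF assms(1)] assms
      subgroup.subset[OF subgroup_generate1] by (simp add: order_def)
  then have "carrier G = range (\<lambda>k::int. x [^] k)"
    using generate_pow[OF assms(1)] by (simp add: full_SetCompr_eq)
  then show ?thesis using assms(1) cyclic_group by blast
qed

text \<open>If all element orders are below 7, oddness leaves 1, 3 and 5. Orders 3 and 5 cannot
  coexist, so all fifth powers or all cubes are trivial, and the excluded small orders leave enough
  room for the matching construction.\<close>

lemma ex_covered:
  assumes odd: "odd (order G)" and n: "order G \<ge> 2"
    and ex: "\<not> (order G = 3 \<or> order G = 5 \<or> (order G = 9 \<and> \<not> cyclic_group G))"
  shows "\<exists>A. half_system A \<and> A \<subseteq> A <#> A"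
proof (cases "\<exists>g\<in>carrier G. ord g \<ge> 7")
  case True
  then show ?thesis using ex_covered_of_large_ord[OF odd] by blast
next
  case False
  have ords: "ord g = 1 \<or> ord g = 3 \<or> ord g = 5" if "g \<in> carrier G" for g
  proof -
    have "ord g < 7" using False that by auto
    then have "ord g \<in> {0, 1, 2, 3, 4, 5, 6}" by auto
    then show ?thesis using odd_ord[OF odd that] by auto
  qed
  show ?thesis
  proof (cases "\<exists>d\<in>carrier G. ord d = 5")
    case True
    then obtain d where d: "d \<in> carrier G" "ord d = 5" by blast
    have "x [^] (5::nat) = \<one>" if x: "x \<in> carrier G" for x
    proof (rule ccontr)
      assume *: "x [^] (5::nat) \<noteq> \<one>"
      then have "ord x \<noteq> 1" "ord x \<noteq> 5" using pow_eq_id[OF x, of 5] by auto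
      then have "ord x = 3" using ords[OF x] by blast
      then have x3: "x [^] (3::nat) = \<one>" using pow_ord_eq_1[OF x] by simp
      have d5: "d [^] (5::nat) = \<one>" using pow_ord_eq_1[OF d(1)] d(2) by simp
      have y: "x \<otimes> d \<in> carrier G" using x d by simp
      have dist: "(x \<otimes> d) [^] i = x [^] i \<otimes> d [^] i" for i :: nat
        using pow_mult_distrib[OF m_comm[OF x d(1)] x d(1)] .
      \<comment> \<open>The orders 3 and 5 would give a product of order 15. Either admissible
        exponent would annihilate one of the two factors wrongly.\<close>
      have "ord (x \<otimes> d) dvd 3 \<or> ord (x \<otimes> d) dvd 5" using ords[OF y] by fastforce
      then consider "(x \<otimes> d) [^] (3::nat) = \<one>" | "(x \<otimes> d) [^] (5::nat) = \<one>"
        using pow_eq_id[OF y] by blast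
      then show False
      proof cases
        case 1
        then have "d [^] (3::nat) = \<one>" using dist[of 3] x3 d(1) by simp
        then show False using pow_eq_id[OF d(1), of 3] d(2) by simp
      next
        case 2
        then show False using dist[of 5] d5 x * by simp
      qed
    qed
    moreover have "5 dvd order G" using ord_dvd_group_order[OF d(1)] d(2) by simp
    then have "order G > 5" using ex n by (auto dest: dvd_imp_le)
    ultimately show ?thesis using ex_covered_of_exponent_5[OF odd] by blast
  next
    case no5: False
    have "ord x dvd 3" if "x \<in> carrier G" for x using ords[OF that] no5 that by auto
    then have e3: "x [^] (3::nat) = \<one>" if "x \<in> carrier G" for x using that pow_eq_id by blast
    have "carrier G \<noteq> {\<one>}" using n by (auto simp: order_def)
    then obtain d where d: "d \<in> carrier G" "d \<noteq> \<one>" using one_closed by blast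
    then have "ord d = 3" using ords[OF d(1)] no5 ord_eq_1[OF d(1)] by auto
    then have d3: "3 dvd order G" using ord_dvd_group_order[OF d(1)] by simp
    have "order G \<noteq> 9"
    proof
      assume o9: "order G = 9"
      then have "cyclic_group G" using ex by blast
      then obtain x where "x \<in> carrier G" "ord x = order G" by (rule ord_eq_order_of_cyclic)
      then show False using ords[of x] o9 by simp
    qed
    moreover have "order G \<noteq> 3" using ex by blast
    moreover obtain k where k: "order G = 3 * k" using d3 by blast
    \<comment> \<open>An odd multiple of 3 other than 3 and 9 is at least 15.\<close>
    ultimately have "k \<noteq> 1" "k \<noteq> 3" "odd k" using odd by auto
    moreover have "k \<noteq> 0" using n k by auto
    ultimately have "k > 3" by presburger
    then have "order G > 9" using k by simp
    then show ?thesis using ex_covered_of_exponent_3[OF odd e3] by blast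
  qed
qed

section \<open>The exceptional orders 3, 5 and 9\<close>

text \<open>Otherwise each element is a product of two distinct others. If
  \<open>b = c \<otimes> e\<close> and \<open>f\<close> is the fourth element, this forces
  \<open>c = e \<otimes> f\<close> and \<open>e = c \<otimes> f\<close>, so \<open>f\<close> would
  be its own inverse.\<close>

lemma not_covered_of_card_4:
  assumes A: "half_system A" "card A = 4" and sq: "\<And>x. x \<in> A \<Longrightarrow> x \<otimes> x \<notin> A"
  shows "\<not> A \<subseteq> A <#> A"
proof
  assume cov: "A \<subseteq> A <#> A"
  note h = half_systemD[OF A(1)]
  have one: "x \<noteq> \<one>" if "x \<in> A" for x using that h(2) by blast
  have prod: "\<exists>y\<in>A. \<exists>z\<in>A. x = y \<otimes> z \<and> y \<noteq> z \<and> y \<noteq> x \<and> z \<noteq> x" if x: "x \<in> A" for x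
  proof -
    obtain y z where yz: "y \<in> A" "z \<in> A" "x = y \<otimes> z" using cov x by (blast elim: set_multE)
    then have "y \<noteq> z" using sq x by blast
    moreover have "y \<noteq> x" "z \<noteq> x" using yz one h(1) by (auto simp: subset_iff)
    ultimately show ?thesis using yz by blast
  qed
  have "A \<noteq> {}" using A(2) by auto
  then obtain b where b: "b \<in> A" by blast
  obtain c e where ce: "c \<in> A" "e \<in> A" "b = c \<otimes> e" "c \<noteq> e" "c \<noteq> b" "e \<noteq> b"
    using prod[OF b] by blast
  have "card (A - {b, c, e}) = 1"
    using A(2) b ce by (subst card_Diff_subset) auto
  then obtain f where "A - {b, c, e} = {f}" by (meson card_1_singletonE)
  then have Aeq: "A = {b, c, e, f}" and fne: "f \<notin> {b, c, e}" using b ce by auto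
  have G: "b \<in> carrier G" "c \<in> carrier G" "e \<in> carrier G" "f \<in> carrier G" using Aeq h(1) by auto
  have ninv: "x \<otimes> y \<noteq> \<one>" if "x \<in> A" "y \<in> A" for x y
    using half_system_one_notin[OF A(1)] set_multI[OF that] by auto
  have c_eq: "c = e \<otimes> f"
  proof -
    obtain x y where xy: "x \<in> {b, e, f}" "y \<in> {b, e, f}" "x \<noteq> y" "c = x \<otimes> y"
      using prod[OF ce(1)] Aeq by auto
    \<comment> \<open>Substituting \<open>b = c \<otimes> e\<close> turns the two alternatives
      involving \<open>b\<close> into \<open>e \<otimes> e = \<one>\<close> and
      \<open>e \<otimes> f = \<one>\<close>.\<close>
    have 1: "c \<noteq> b \<otimes> e"
    proof
      assume "c = b \<otimes> e"
      then have "c = c \<otimes> (e \<otimes> e)" using ce(3) G by (simp add: m_assoc)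
      then show False using G ninv[of e e] ce by simp
    qed
    have 2: "c \<noteq> b \<otimes> f"
    proof
      assume "c = b \<otimes> f"
      then have "c = c \<otimes> (e \<otimes> f)" using ce(3) G by (simp add: m_assoc)
      then show False using G ninv[of e f] Aeq by simp
    qed
    show ?thesis using xy 1 2 m_comm[OF G(3,1)] m_comm[OF G(4,1)] m_comm[OF G(4,3)] by auto
  qed
  have e_eq: "e = c \<otimes> f"
  proof -
    obtain x y where xy: "x \<in> {b, c, f}" "y \<in> {b, c, f}" "x \<noteq> y" "e = x \<otimes> y"
      using prod[OF ce(2)] Aeq by auto
    have 1: "e \<noteq> b \<otimes> c"
    proof
      assume "e = b \<otimes> c"
      then have "e = e \<otimes> (c \<otimes> c)" using ce(3) G by (simp add: m_ac)
      then show False using G ninv[of c c] ce by simp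
    qed
    have 2: "e \<noteq> b \<otimes> f"
    proof
      assume "e = b \<otimes> f"
      then have "e = e \<otimes> (c \<otimes> f)" using ce(3) G by (simp add: m_ac)
      then show False using G ninv[of c f] Aeq by simp
    qed
    show ?thesis using xy 1 2 m_comm[OF G(2,1)] m_comm[OF G(4,1)] m_comm[OF G(4,2)] by auto
  qed
  have "c = c \<otimes> (f \<otimes> f)" using c_eq e_eq G by (metis m_assoc)
  then show False using G ninv[of f f] Aeq by simp
qed

text \<open>In order 3, the single element of \<open>A\<close> is not its own square. In order 5,
  the two elements would be each other's squares, so their orders would divide 3. In noncyclic order
  9 all cubes are trivial, so squares are inverses and the four-element argument applies.\<close>

lemma not_covered_small:
  assumes A: "half_system A" and ex: "order G = 3 \<or> order G = 5 \<or> (order G = 9 \<and> \<not> cyclic_group G)"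
  shows "\<not> A \<subseteq> A <#> A"
proof -
  note h = half_systemD[OF A]
  have card: "2 * card A = order G - 1" using half_system_card[OF A] .
  from ex consider "order G = 3" | "order G = 5" | "order G = 9" "\<not> cyclic_group G" by blast
  then show ?thesis
  proof cases
    case 1
    then obtain a where a: "A = {a}" using card card_1_singletonE[of A] by auto
    then have "a \<in> carrier G" "a \<noteq> \<one>" using h by auto
    then show ?thesis using a unfolding set_mult_def by auto
  next
    case 2
    then have "card A = 2" using card by simp
    then obtain a b where ab: "A = {a, b}" "a \<noteq> b" by (auto simp: card_2_iff)
    then have G: "a \<in> carrier G" "b \<in> carrier G" "a \<noteq> \<one>" "b \<noteq> \<one>" using h by auto
    show ?thesis
    proof
      assume "A \<subseteq> A <#> A"
      then have "a \<in> A <#> A" "b \<in> A <#> A" using ab by auto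
      moreover have AA: "A <#> A = {a \<otimes> a, a \<otimes> b, b \<otimes> a, b \<otimes> b}"
        unfolding ab(1) set_mult_def by auto
      ultimately have "a \<in> {a \<otimes> a, a \<otimes> b, b \<otimes> a, b \<otimes> b}" "b \<in> {a \<otimes> a, a \<otimes> b, b \<otimes> a, b \<otimes> b}"
        by (simp_all only:)
      then have "a = b \<otimes> b \<or> a = a \<otimes> a \<or> a = a \<otimes> b \<or> a = b \<otimes> a"
        "b = a \<otimes> a \<or> b = b \<otimes> b \<or> b = a \<otimes> b \<or> b = b \<otimes> a"
        by (simp_all only: insert_iff empty_iff) blast+
      then have "a = b \<otimes> b" "b = a \<otimes> a"
        using G by simp_all
      then have "a = (a \<otimes> a) \<otimes> (a \<otimes> a)" by metis
      then have "a \<otimes> (a \<otimes> (a \<otimes> a)) = a" using G(1) by (metis m_assoc m_closed)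
      then have "a [^] (3::nat) = \<one>" using G nat_pow_numeral_simps(2)[OF G(1)] by simp
      then have "ord a dvd 3" using pow_eq_id[OF G(1)] by simp
      moreover have "ord a dvd 5" using ord_dvd_group_order[OF G(1)] 2 by simp
      ultimately have "ord a dvd gcd 3 5" by (rule gcd_greatest)
      moreover have "gcd 3 (5::nat) = 1" by (simp add: gcd_non_0_nat)
      ultimately have "ord a = 1" by simp
      then show False using ord_eq_1 G by blast
    qed
  next
    case 3
    have e3: "x \<otimes> (x \<otimes> x) = \<one>" if x: "x \<in> carrier G" for x
    proof -
      have d9: "ord x dvd 3 ^ 2" using ord_dvd_group_order[OF x] 3(1) by simp
      obtain i where i: "i \<le> 2" "ord x = 3 ^ i"
        using divides_primepow_nat[of 3 "ord x" 2] d9 by auto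
      have "i \<noteq> 2" using cyclic_of_ord[OF x] 3 i by auto
      then have "i \<le> 1" using i by simp
      then have "ord x dvd 3" using i(2) le_imp_power_dvd[of i 1 "3::nat"] by simp
      then show ?thesis using pow_eq_id[OF x, of 3] nat_pow_numeral_simps(2)[OF x] by simp
    qed
    show ?thesis
    proof (rule not_covered_of_card_4[OF A])
      show "card A = 4" using card 3 by simp
      fix x assume x: "x \<in> A"
      then have xG: "x \<in> carrier G" using h(1) by blast
      have "x \<otimes> x = inv x"
        using e3[OF xG] xG by (intro inv_equality[symmetric]) (simp_all add: m_assoc)
      then show "x \<otimes> x \<notin> A" using h(3)[OF x] by simp
    qed
  qed
qed

section \<open>Assembly for odd order\<close>

lemma odd_case:
  assumes odd: "odd (order G)" and n: "order G \<ge> 2"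
  shows "Max {card A | A. incomplete G 2 A} = (order G - 1) div 2"
    and "incomplete_sizes G 2 =
      (if order G = 3 \<or> order G = 5 \<or> (order G = 9 \<and> \<not> cyclic_group G)
       then {order G - 2} else {order G - 2, order G - 1})"
proof -
  let ?N = "(order G - 1) div 2"
  have N: "2 * ?N = order G - 1" using odd n by simp
  have half_good: "B \<subseteq> carrier G \<and> B <#> B \<noteq> carrier G \<and> card B = ?N" if "half_system B" for B
    using half_systemD(1)[OF that] half_system_one_notin[OF that] half_system_card[OF that] by auto
  have "carrier G \<noteq> {\<one>}" using n by (auto simp: order_def)
  then obtain g where g: "g \<in> carrier G" "g \<noteq> \<one>" using one_closed by blast
  obtain B where B: "half_system B" "\<not> B \<subseteq> B <#> B"
    using ex_half_system_not_covered[OF odd g] by blast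
  have le: "card A \<le> ?N" if "A \<subseteq> carrier G" "A <#> A \<noteq> carrier G" for A
    using card_incomplete[OF that] odd n by presburger
  have N1: "1 \<le> ?N" using N n odd by presburger
  note max = maximum_incomplete[OF N1 le, of B]
  show "Max {card A | A. incomplete G 2 A} = ?N" using max(1) half_good[OF B(1)] by blast
  have "incomplete_sizes G 2 =
      {card (A <#> A) | A. A \<subseteq> carrier G \<and> A <#> A \<noteq> carrier G \<and> card A = ?N}"
    using max(2) half_good[OF B(1)] by blast
  also have "\<dots> = {card (A <#> A) | A. half_system A}"
  proof
    show "{card (A <#> A) | A. half_system A} \<subseteq>
      {card (A <#> A) | A. A \<subseteq> carrier G \<and> A <#> A \<noteq> carrier G \<and> card A = ?N}"
      using half_good by blast
    show "{card (A <#> A) | A. A \<subseteq> carrier G \<and> A <#> A \<noteq> carrier G \<and> card A = ?N}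
      \<subseteq> {card (A <#> A) | A. half_system A}"
    proof
      fix s assume "s \<in> {card (A <#> A) | A. A \<subseteq> carrier G \<and> A <#> A \<noteq> carrier G \<and> card A = ?N}"
      then obtain A where A: "s = card (A <#> A)" "A \<subseteq> carrier G" "A <#> A \<noteq> carrier G" "card A = ?N"
        by blast
      have AA: "A <#> A \<subseteq> carrier G" using set_mult_closed[OF A(2,2)] .
      then obtain c where c: "c \<in> carrier G" "c \<notin> A <#> A" using A(3) by blast
      \<comment> \<open>Translating by the inverse of a square root moves the missing element
        \<open>c\<close> to \<open>\<one>\<close>, so every maximum incomplete set is a translate of
        a half system.\<close>
      obtain t where t: "t \<in> carrier G" "t \<otimes> t = c"
        using square_root[OF odd c(1)] c(1) by blast
      let ?B = "(\<otimes>) (inv t) ` A"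
      have BB: "?B <#> ?B = (\<otimes>) (inv t \<otimes> inv t) ` (A <#> A)"
        using set_mult_translate[OF A(2), of "inv t"] t(1) by simp
      have "\<one> \<notin> ?B <#> ?B"
      proof
        assume "\<one> \<in> ?B <#> ?B"
        then obtain a where a: "a \<in> A <#> A" "\<one> = (inv t \<otimes> inv t) \<otimes> a" unfolding BB by blast
        have aG: "a \<in> carrier G" using a AA by blast
        have "c = c \<otimes> ((inv t \<otimes> inv t) \<otimes> a)" using a(2)[symmetric] c(1) by simp
        also have "\<dots> = a" using t aG by (simp flip: t(2) add: m_assoc)
        finally show False using a(1) c(2) by simp
      qed
      moreover have "?B \<subseteq> carrier G" using A(2) t(1) by (auto simp: subset_iff)
      moreover have "2 * card ?B = order G - 1"
        using card_translate[OF A(2), of "inv t"] t(1) A(4) N by simp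
      ultimately have "half_system ?B" by (intro half_systemI)
      moreover have "card (?B <#> ?B) = s" unfolding BB A(1) using AA t(1) by (simp add: card_translate)
      ultimately show "s \<in> {card (A <#> A) | A. half_system A}" by blast
    qed
  qed
  also have "\<dots> = (if order G = 3 \<or> order G = 5 \<or> (order G = 9 \<and> \<not> cyclic_group G)
       then {order G - 2} else {order G - 2, order G - 1})"
  proof -
    let ?S = "{card (A <#> A) | A. half_system A}"
    define S where "S = ?S"
    define E where "E \<longleftrightarrow> order G = 3 \<or> order G = 5 \<or> (order G = 9 \<and> \<not> cyclic_group G)"
    have SI: "card (A <#> A) \<in> S" if "half_system A" for A using that unfolding S_def by blast
    have 1: "order G - 2 \<in> S" using half_system_sumset_card[OF odd B(1)] B SI[OF B(1)] by simp
    have 2: "order G - 1 \<in> S" if ne: "\<not> E"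
    proof -
      obtain A where A: "half_system A" "A \<subseteq> A <#> A" using ex_covered[OF odd n] ne E_def by blast
      then show ?thesis using half_system_sumset_card[OF odd A(1)] SI[OF A(1)] by simp
    qed
    have 3: "s = order G - 2 \<or> (s = order G - 1 \<and> \<not> E)" if sS: "s \<in> S" for s
    proof -
      obtain A where A: "half_system A" "s = card (A <#> A)" using sS unfolding S_def by blast
      show ?thesis
      proof (cases "A \<subseteq> A <#> A")
        case True
        then have "\<not> E" using not_covered_small[OF A(1)] unfolding E_def by blast
        moreover have "s = order G - 1"
          using half_system_sumset_card[OF odd A(1)] True unfolding A(2) by simp
        ultimately show ?thesis by blast
      next
        case False
        then show ?thesis using half_system_sumset_card[OF odd A(1)] unfolding A(2) by simp
      qed
    qed
    have "S = {order G - 2}" if "E" using 1 3 that by blast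
    moreover have "S = {order G - 2, order G - 1}" if "\<not> E" using 1 2 3 that by blast
    ultimately have "S = (if E then {order G - 2} else {order G - 2, order G - 1})" by presburger
    then show ?thesis unfolding S_def E_def .
  qed
  finally show "incomplete_sizes G 2 =
      (if order G = 3 \<or> order G = 5 \<or> (order G = 9 \<and> \<not> cyclic_group G)
       then {order G - 2} else {order G - 2, order G - 1})" .
qed

section \<open>Exponent and subgroups\<close>

text \<open>The order of the group is an admissible exponent, so the \<open>LEAST\<close> in
  \<open>group_exponent\<close> is attained.\<close>

lemma pow_group_exponent:
  assumes "x \<in> carrier G"
  shows "x [^] group_exponent G = \<one>"
proof -
  have "0 < order G \<and> (\<forall>x\<in>carrier G. x [^] order G = \<one>)"
    using pow_order_eq_1 finite_carrier order_gt_0_iff_finite by blast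
  then have "0 < group_exponent G \<and> (\<forall>x\<in>carrier G. x [^] group_exponent G = \<one>)"
    unfolding group_exponent_def by (rule LeastI)
  then show ?thesis using assms by blast
qed

text \<open>The remainder of \<open>f\<close> modulo the exponent annihilates every element too, and
  minimality makes it zero.\<close>

lemma group_exponent_dvd:
  assumes f: "\<And>x. x \<in> carrier G \<Longrightarrow> x [^] (f::nat) = \<one>" and "0 < f"
  shows "group_exponent G dvd f"
proof -
  let ?e = "group_exponent G"
  have "0 < f \<and> (\<forall>x\<in>carrier G. x [^] f = \<one>)" using assms by blast
  then have pos: "0 < ?e"
    unfolding group_exponent_def using LeastI[of "\<lambda>e. 0 < e \<and> (\<forall>x\<in>carrier G. x [^] e = \<one>)" f] by blast
  have r: "x [^] (f mod ?e) = \<one>" if x: "x \<in> carrier G" for x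
  proof -
    have "ord x dvd f" "ord x dvd ?e" using f[OF x] pow_group_exponent[OF x] pow_eq_id[OF x] by auto
    then have "ord x dvd f mod ?e" by (simp add: dvd_mod)
    then show ?thesis using pow_eq_id[OF x] by blast
  qed
  have "f mod ?e = 0"
  proof (rule ccontr)
    assume "f mod ?e \<noteq> 0"
    then have "?e \<le> f mod ?e" unfolding group_exponent_def using r
      by (intro Least_le) (auto simp: group_exponent_def)
    then show False using pos mod_less_divisor[OF pos, of f] by linarith
  qed
  then show ?thesis by (simp add: mod_eq_0_iff_dvd)
qed

text \<open>By counting, \<open>M\<close> is the disjoint union of \<open>L\<close> and
  \<open>L #> z\<close>.\<close>

lemma subgroup_mem_iff_of_index_2:
  assumes L: "subgroup L G" and M: "subgroup M G" and LM: "L \<subseteq> M" "card M = 2 * card L"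
    and z: "z \<in> M" "z \<notin> L" and x: "x \<in> M" "x \<notin> L"
  shows "x \<otimes> inv z \<in> L"
proof -
  have G: "z \<in> carrier G" "x \<in> carrier G" "M \<subseteq> carrier G" using z x subgroup.subset[OF M] by auto
  have sub: "L \<union> (L #> z) \<subseteq> M"
    using LM(1) z(1) subgroup.m_closed[OF M] unfolding r_coset_def by auto
  have disj: "L \<inter> (L #> z) = {}"
    unfolding r_coset_def using subgroup_mult_mem_iff(1)[OF L _ G(1)] z(2) by auto
  have "finite (L \<union> (L #> z))" using sub G(3) finite_subset_carrier by blast
  then have "card (L \<union> (L #> z)) = card M"
    using card_Un_disjoint[OF _ _ disj] card_r_coset[OF L G(1)] LM(2) by simp
  then have "L \<union> (L #> z) = M"
    using card_subset_eq[OF _ sub] G(3) finite_subset_carrier by blast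
  then show ?thesis using x mem_r_coset_iff[OF L G(1,2)] by blast
qed

text \<open>A square outside \<open>L\<close> would share the coset of \<open>z\<close>, and
  cancelling one factor would put \<open>z\<close> in \<open>L\<close>.\<close>

lemma square_mem_of_index_2:
  assumes L: "subgroup L G" and M: "subgroup M G" and LM: "L \<subseteq> M" "card M = 2 * card L"
    and z: "z \<in> M"
  shows "z \<otimes> z \<in> L"
proof (cases "z \<in> L")
  case True then show ?thesis using subgroup.m_closed[OF L] by blast
next
  case False
  have zG: "z \<in> carrier G" using z subgroup.subset[OF M] by auto
  show ?thesis
  proof (rule ccontr)
    assume "z \<otimes> z \<notin> L"
    then have "(z \<otimes> z) \<otimes> inv z \<in> L"
      using subgroup_mem_iff_of_index_2[OF L M LM z False] subgroup.m_closed[OF M z z] by blast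
    then show False using False zG by (simp add: m_assoc)
  qed
qed

lemma subgroup_double:
  assumes H: "subgroup H G" and y: "y \<in> carrier G" "y \<otimes> y \<in> H" "y \<notin> H"
  shows "subgroup (H \<union> (H #> y)) G" "card (H \<union> (H #> y)) = 2 * card H"
proof -
  have HG: "H \<subseteq> carrier G" using H by (rule subgroup.subset)
  have cG: "H #> y \<subseteq> carrier G" using HG y(1) by (rule r_coset_subset_G)
  note mc = mem_r_coset_iff[OF H y(1)]
  show "subgroup (H \<union> (H #> y)) G"
  proof (rule subgroupI)
    show "H \<union> (H #> y) \<subseteq> carrier G" using HG cG by blast
    show "H \<union> (H #> y) \<noteq> {}" using subgroup.one_closed[OF H] by blast
    fix a assume a: "a \<in> H \<union> (H #> y)"
    then have aG: "a \<in> carrier G" using HG cG by blast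
    show "inv a \<in> H \<union> (H #> y)"
    proof (cases "a \<in> H")
      case False
      then have "a \<otimes> inv y \<in> H" using a mc[OF aG] by blast
      then have "(a \<otimes> inv y) \<otimes> (y \<otimes> y) \<in> H" by (rule subgroup.m_closed[OF H _ y(2)])
      moreover have "(a \<otimes> inv y) \<otimes> (y \<otimes> y) = inv (inv a \<otimes> inv y)"
        using aG y(1) by (simp add: inv_mult m_assoc)
      ultimately have "inv a \<otimes> inv y \<in> H" using subgroup_inv_mem_iff[OF H, of "inv a \<otimes> inv y"] aG y(1) by simp
      then show ?thesis using mc[of "inv a"] aG by blast
    qed (use subgroup.m_inv_closed[OF H] in blast)
    fix b assume b: "b \<in> H \<union> (H #> y)"
    then have bG: "b \<in> carrier G" using HG cG by blast
    consider "a \<in> H" "b \<in> H" | "a \<in> H" "b \<otimes> inv y \<in> H" | "a \<otimes> inv y \<in> H" "b \<in> H"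
      | "a \<otimes> inv y \<in> H" "b \<otimes> inv y \<in> H"
      using a b mc[OF aG] mc[OF bG] by blast
    then show "a \<otimes> b \<in> H \<union> (H #> y)"
    proof cases
      case 1
      then show ?thesis using subgroup.m_closed[OF H] by blast
    next
      case 2
      then have "a \<otimes> (b \<otimes> inv y) \<in> H" using subgroup.m_closed[OF H] by blast
      then show ?thesis using mc[of "a \<otimes> b"] aG bG y(1) by (simp add: m_assoc)
    next
      case 3
      then have "b \<otimes> (a \<otimes> inv y) \<in> H" using subgroup.m_closed[OF H] by blast
      then show ?thesis using mc[of "a \<otimes> b"] aG bG y(1) by (simp add: m_assoc m_lcomm)
    next
      case 4
      then have "(a \<otimes> inv y) \<otimes> (b \<otimes> inv y) \<in> H" using subgroup.m_closed[OF H] by blast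
      then have "((a \<otimes> inv y) \<otimes> (b \<otimes> inv y)) \<otimes> (y \<otimes> y) \<in> H" by (rule subgroup.m_closed[OF H _ y(2)])
      moreover have "((a \<otimes> inv y) \<otimes> (b \<otimes> inv y)) \<otimes> (y \<otimes> y) = a \<otimes> b"
      proof -
        have "(a \<otimes> inv y) \<otimes> (b \<otimes> inv y) = (a \<otimes> b) \<otimes> inv (y \<otimes> y)"
          by (subst m_middle) (use aG bG y(1) in \<open>auto simp: inv_mult\<close>)
        then show ?thesis using aG bG y(1) by (simp add: m_assoc)
      qed
      ultimately show ?thesis by simp
    qed
  qed
  have "H \<inter> (H #> y) = {}"
    unfolding r_coset_def using subgroup_mult_mem_iff(1)[OF H _ y(1)] y(3) by auto
  then show "card (H \<union> (H #> y)) = 2 * card H"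
    using card_Un_disjoint[of H "H #> y"] HG cG finite_subset_carrier card_r_coset[OF H y(1)] by simp
qed

text \<open>Strong induction on \<open>k\<close>: the quotient by \<open>K\<close> has a subgroup of
  prime order \<open>p\<close> dividing \<open>k\<close>, its preimage enlarges \<open>K\<close> by
  the factor \<open>p\<close>, and the cofactor is handled by induction.\<close>

lemma ex_subgroup_card_between:
  assumes "subgroup K G" "card K * k dvd order G"
  shows "\<exists>M. subgroup M G \<and> K \<subseteq> M \<and> card M = card K * k"
  using assms
proof (induction k arbitrary: K rule: less_induct)
  case (less k)
  note K = less.prems(1)
  have pos: "0 < card K * k"
    using less.prems(2) finite_carrier order_gt_0_iff_finite by (metis dvd_0_left_iff gr0I less_numeral_extra(3))
  show ?case
  proof (cases "k = 1")
    case True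
    then show ?thesis using K by auto
  next
    case False
    then obtain p where p: "Factorial_Ring.prime p" "p dvd k" using prime_factor_nat by blast
    interpret N: normal K G using subgroup_imp_normal[OF K] .
    let ?Q = "G Mod K"
    have Q: "group ?Q" by (rule N.factorgroup_is_group)
    have oQ: "order ?Q * card K = order G"
      using lagrange[OF K] by (simp add: FactGroup_def order_def)
    have "card K * k dvd card K * order ?Q" using less.prems(2) oQ by (simp add: mult.commute)
    then have "k dvd order ?Q" using pos by simp
    \<comment> \<open>Only one factor \<open>p\<close> is split off, so Sylow's theorem serves as
      Cauchy's theorem.\<close>
    then obtain m where "order ?Q = p ^ 1 * m" using p(2) by (metis dvd_def dvd_trans power_one_right)
    moreover have "finite (carrier ?Q)" using finite_carrier by (simp add: carrier_FactGroup)
    ultimately obtain P where P: "subgroup P ?Q" "card P = p ^ 1"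
      using sylow_thm[OF p(1) Q] by blast
    define M where "M = {x \<in> carrier G. K #> x \<in> P}"
    have hom: "K #> (x \<otimes> y) = (K #> x) <#> (K #> y)" if "x \<in> carrier G" "y \<in> carrier G" for x y
      using N.rcos_sum[OF that] by simp
    have K1: "K #> x = K" if "x \<in> K" for x
      using coset_join2[OF _ K that] subgroup.mem_carrier[OF K that] by blast
    have KP: "K \<in> P" using subgroup.one_closed[OF P(1)] by simp
    have M: "subgroup M G"
    proof (rule subgroupI)
      show "M \<subseteq> carrier G" unfolding M_def by blast
      show "M \<noteq> {}" using K1 KP subgroup.one_closed[OF K] unfolding M_def by auto
      fix a assume a: "a \<in> M"
      then have "inv\<^bsub>?Q\<^esub> (K #> a) \<in> P" using subgroup.m_inv_closed[OF P(1)] unfolding M_def by blast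
      moreover have "inv\<^bsub>?Q\<^esub> (K #> a) = K #> inv a"
        using a N.inv_FactGroup[of "K #> a"] N.rcos_inv[of a] unfolding M_def by (auto simp: carrier_FactGroup)
      ultimately show "inv a \<in> M" using a unfolding M_def by simp
      fix b assume b: "b \<in> M"
      have "(K #> a) <#> (K #> b) \<in> P"
        using subgroup.m_closed[OF P(1), of "K #> a" "K #> b"] a b unfolding M_def by simp
      then show "a \<otimes> b \<in> M" using a b hom unfolding M_def by simp
    qed
    have KM: "K \<subseteq> M" using K1 KP subgroup.mem_carrier[OF K] unfolding M_def by auto
    have Psub: "P \<subseteq> rcosets K" using subgroup.subset[OF P(1)] by (simp add: FactGroup_def)
    have UP: "\<Union>P = M"
    proof
      show "M \<subseteq> \<Union>P" unfolding M_def using rcos_self[OF _ K] by blast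
      show "\<Union>P \<subseteq> M"
      proof
        fix x assume "x \<in> \<Union>P"
        then obtain c where c: "c \<in> P" "x \<in> c" by blast
        then obtain g where g: "g \<in> carrier G" "c = K #> g" using Psub unfolding RCOSETS_def by blast
        then have "x \<in> carrier G" using c r_coset_subset_G[OF subgroup.subset[OF K]] by blast
        moreover have "K #> x = c" using repr_independence[of x K g] c g K by simp
        ultimately show "x \<in> M" using c unfolding M_def by simp
      qed
    qed
    have "finite M" using M subgroup.subset finite_subset_carrier by blast
    have "card K * card P = card (\<Union>P)"
    proof (rule card_partition)
      show "finite (\<Union>P)" using UP \<open>finite M\<close> by simp
      then show "finite P" by (rule finite_UnionD)
      show "card c = card K" if "c \<in> P" for c
        using card_rcosets_equal[of c K] that Psub subgroup.subset[OF K] by auto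
      show "c1 \<inter> c2 = {}" if "c1 \<in> P" "c2 \<in> P" "c1 \<noteq> c2" for c1 c2
        using rcos_disjoint[OF K] that Psub unfolding pairwise_def disjnt_def by blast
    qed
    then have cM: "card M = card K * p" using UP P(2) by simp
    obtain k' where k': "k = p * k'" using p(2) by blast
    have "0 < k'" using k' pos by (cases k') auto
    then have "k' < k" using k' prime_gt_1_nat[OF p(1)] by simp
    moreover have "card M * k' dvd order G" using less.prems(2) cM k' by (simp add: mult.assoc)
    ultimately obtain M' where "subgroup M' G" "M \<subseteq> M'" "card M' = card M * k'"
      using less.IH[OF _ M] by blast
    then show ?thesis using KM cM k' by (auto simp: mult.assoc)
  qed
qed

section \<open>Groups of even order\<close>

text \<open>Only an inclusion of the translate in \<open>A\<close> is required; for finite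
  \<open>A\<close> it is an equality.\<close>

definition stabilizer_of :: "'a set \<Rightarrow> 'a set" where
  "stabilizer_of A = {h \<in> carrier G. \<forall>a\<in>A. h \<otimes> a \<in> A}"

lemma subgroup_stabilizer_of:
  assumes "A \<subseteq> carrier G"
  shows "subgroup (stabilizer_of A) G"
proof (rule subgroupI)
  show "stabilizer_of A \<subseteq> carrier G" unfolding stabilizer_of_def by blast
  have "\<one> \<in> stabilizer_of A" unfolding stabilizer_of_def using assms by (auto simp: subset_iff)
  then show "stabilizer_of A \<noteq> {}" by blast
  have D: "h \<otimes> a \<in> A" if "h \<in> stabilizer_of A" "a \<in> A" for h a
    using that unfolding stabilizer_of_def by simp
  fix h assume h: "h \<in> stabilizer_of A"
  have hG: "h \<in> carrier G" using h unfolding stabilizer_of_def by simp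
  have "inj_on ((\<otimes>) h) A"
  proof (rule inj_onI)
    fix x y assume "x \<in> A" "y \<in> A" "h \<otimes> x = h \<otimes> y"
    then show "x = y" using hG subsetD[OF assms] by simp
  qed
  moreover have "(\<otimes>) h ` A \<subseteq> A" using D[OF h] by (rule image_subsetI)
  \<comment> \<open>An injective self-map of a finite set is onto, which gives closure under
    inverses.\<close>
  ultimately have img: "(\<otimes>) h ` A = A" by (intro endo_inj_surj[OF finite_subset_carrier[OF assms]])
  have "inv h \<otimes> a \<in> A" if a: "a \<in> A" for a
  proof -
    have "a \<in> (\<otimes>) h ` A" using a img by simp
    then obtain b where "a = h \<otimes> b" "b \<in> A" by (rule imageE)
    then show ?thesis using hG subsetD[OF assms] by simp
  qed
  then show "inv h \<in> stabilizer_of A" using hG unfolding stabilizer_of_def by simp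
  fix k assume k: "k \<in> stabilizer_of A"
  have kG: "k \<in> carrier G" using k unfolding stabilizer_of_def by simp
  have "(h \<otimes> k) \<otimes> a \<in> A" if a: "a \<in> A" for a
    using D[OF h D[OF k a]] hG kG subsetD[OF assms a] by (simp add: m_assoc)
  then show "h \<otimes> k \<in> stabilizer_of A" using hG kG unfolding stabilizer_of_def by simp
qed

lemma coset_union_card_dvd:
  assumes K: "subgroup K G" and A: "coset_union K A"
  shows "card K dvd card A"
proof -
  have AG: "A \<subseteq> carrier G" using A unfolding coset_union_def by blast
  let ?C = "(\<lambda>a. K #> a) ` A"
  have sub: "?C \<subseteq> rcosets K" using AG unfolding RCOSETS_def by blast
  have U: "\<Union>?C = A"
  proof
    show "\<Union>?C \<subseteq> A" using coset_unionD[OF A] unfolding r_coset_def by auto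
    show "A \<subseteq> \<Union>?C" using rcos_self[OF _ K] AG by blast
  qed
  have "card K * card ?C = card (\<Union>?C)"
  proof (rule card_partition)
    show "finite ?C" using finite_subset_carrier[OF AG] by simp
    show "finite (\<Union>?C)" unfolding U by (rule finite_subset_carrier[OF AG])
    show "card c = card K" if "c \<in> ?C" for c using that card_r_coset[OF K] AG by blast
    show "c1 \<inter> c2 = {}" if "c1 \<in> ?C" "c2 \<in> ?C" "c1 \<noteq> c2" for c1 c2
      using rcos_disjoint[OF K] that sub unfolding pairwise_def disjnt_def by blast
  qed
  then show ?thesis unfolding U by (metis dvd_triv_left)
qed

text \<open>The reflection of \<open>A\<close> through \<open>g\<close> is the whole complement, so
  failure to lie in \<open>A\<close> can be rewritten as membership of the reflected point. The
  condition that \<open>y\<close> is missing becomes that \<open>inv (y \<otimes> inv g)\<close>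
  stabilizes \<open>A\<close>.\<close>

lemma missing_products_even:
  assumes A: "A \<subseteq> carrier G" "2 * card A = order G" and g: "g \<in> carrier G" "g \<notin> A <#> A"
  shows "carrier G - (A <#> A) = stabilizer_of A #> g"
proof -
  let ?H = "stabilizer_of A"
  note H = subgroup_stabilizer_of[OF A(1)]
  let ?R = "(\<lambda>a. inv a \<otimes> g) ` A"
  have disj: "A \<inter> ?R = {}" using not_in_set_mult_iff[OF A(1) g(1)] g(2) by auto
  have RG: "?R \<subseteq> carrier G" using A(1) g(1) by auto
  have "card (A \<union> ?R) = order G"
    using card_Un_disjoint[OF _ _ disj] finite_subset_carrier A(1) RG card_reflect[OF A(1) g(1)] A(2) by simp
  then have AR: "A \<union> ?R = carrier G"
    using card_subset_eq[OF finite_carrier, of "A \<union> ?R"] A(1) RG by (simp add: order_def)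
  have mem: "z \<in> A \<longleftrightarrow> inv z \<otimes> g \<notin> A" if z: "z \<in> carrier G" for z
  proof
    assume "z \<in> A" then show "inv z \<otimes> g \<notin> A" using not_in_set_mult_iff[OF A(1) g(1)] g(2) by blast
  next
    assume n: "inv z \<otimes> g \<notin> A"
    show "z \<in> A"
    proof (rule ccontr)
      assume "z \<notin> A"
      then obtain a where a: "a \<in> A" "z = inv a \<otimes> g" using AR z by blast
      have "a \<in> carrier G" using a A(1) by blast
      then have "inv z \<otimes> g = a" using a(2) g(1) by (simp add: inv_mult m_assoc)
      then show False using n a by simp
    qed
  qed
  have "y \<notin> A <#> A \<longleftrightarrow> y \<in> ?H #> g" if y: "y \<in> carrier G" for y
  proof -
    let ?h = "y \<otimes> inv g"
    have hG: "?h \<in> carrier G" using y g by simp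
    have "inv a \<otimes> y \<notin> A \<longleftrightarrow> inv ?h \<otimes> a \<in> A" if "a \<in> A" for a
    proof -
      have aG: "a \<in> carrier G" using that A(1) by blast
      have "inv (inv ?h \<otimes> a) \<otimes> g = (y \<otimes> inv g) \<otimes> (inv a \<otimes> g)"
        using y g(1) aG by (simp add: inv_mult m_assoc)
      also have "\<dots> = inv a \<otimes> y"
        by (subst m_middle) (use y g(1) aG m_comm[OF y, of "inv a"] in auto)
      finally have "inv (inv ?h \<otimes> a) \<otimes> g = inv a \<otimes> y" .
      moreover have "inv ?h \<otimes> a \<in> carrier G" by (rule m_closed[OF inv_closed[OF hG] aG])
      ultimately show ?thesis using mem by metis
    qed
    then have "y \<notin> A <#> A \<longleftrightarrow> inv ?h \<in> ?H"
      using not_in_set_mult_iff[OF A(1) y] hG unfolding stabilizer_of_def by auto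
    also have "\<dots> \<longleftrightarrow> ?h \<in> ?H" using subgroup_inv_mem_iff[OF H hG] .
    also have "\<dots> \<longleftrightarrow> y \<in> ?H #> g" using mem_r_coset_iff[OF H g(1) y] by simp
    finally show ?thesis .
  qed
  moreover have "?H #> g \<subseteq> carrier G" using r_coset_subset_G[OF subgroup.subset[OF H] g(1)] .
  ultimately show ?thesis by blast
qed

lemma sumset_card_even:
  assumes A: "A \<subseteq> carrier G" "2 * card A = order G" "A <#> A \<noteq> carrier G"
  shows "card (A <#> A) = order G - card (stabilizer_of A)"
proof -
  have AA: "A <#> A \<subseteq> carrier G" using set_mult_closed[OF A(1,1)] .
  then obtain g where g: "g \<in> carrier G" "g \<notin> A <#> A" using A(3) by blast
  have "card (carrier G - (A <#> A)) = card (stabilizer_of A)"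
    using missing_products_even[OF A(1,2) g] card_r_coset[OF subgroup_stabilizer_of[OF A(1)] g(1)] by simp
  moreover have "card (carrier G - (A <#> A)) = order G - card (A <#> A)"
    using card_Diff_subset[OF finite_subset_carrier[OF AA] AA] by (simp add: order_def)
  moreover have "card (A <#> A) \<le> order G" using AA card_mono[OF finite_carrier] by (simp add: order_def)
  ultimately show ?thesis by simp
qed

text \<open>The coset of \<open>x\<close> has order exactly 4 in a quotient of order 4, so 4 divides
  every exponent that annihilates it.\<close>

lemma four_dvd_group_exponent:
  assumes H: "subgroup H G" "order G = 4 * card H" and x: "x \<in> carrier G" "x \<otimes> x \<notin> H"
  shows "4 dvd group_exponent G"
proof -
  have xH: "x \<notin> H" using x subgroup.m_closed[OF H(1)] by blast
  have cH: "card H > 0" using H finite_carrier order_gt_0_iff_finite by auto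
  interpret N: normal H G using subgroup_imp_normal[OF H(1)] .
  have "order (G Mod H) * card H = order G"
    using lagrange[OF H(1)] by (simp add: FactGroup_def order_def)
  then have oQ: "order (G Mod H) = 4" using H(2) cH by simp
  have "(H #> x) [^]\<^bsub>G Mod H\<^esub> order (G Mod H) = \<one>\<^bsub>G Mod H\<^esub>"
    using group.pow_order_eq_1[OF N.factorgroup_is_group] x(1) by (simp add: carrier_FactGroup)
  then have "H #> (x [^] (4::nat)) = H" using N.FactGroup_pow[OF x(1)] oQ by simp
  then have x4: "x [^] (4::nat) \<in> H" using rcos_self[OF _ H(1), of "x [^] (4::nat)"] x(1) by simp
  let ?e = "group_exponent G"
  \<comment> \<open>Division with remainder: the power of \<open>x\<close> to
    \<open>?e mod 4\<close> lies in \<open>H\<close>, and the nonzero remainders are then excluded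
    one by one.\<close>
  have "x [^] ?e = (x [^] (4::nat)) [^] (?e div 4) \<otimes> x [^] (?e mod 4)"
    using x(1) by (simp add: nat_pow_pow nat_pow_mult)
  moreover have "(x [^] (4::nat)) [^] (?e div 4) \<in> H" using subgroup_nat_pow[OF H(1) x4] .
  ultimately have r: "x [^] (?e mod 4) \<in> H"
    using subgroup_mult_mem_iff(1)[OF H(1), of "(x [^] (4::nat)) [^] (?e div 4)" "x [^] (?e mod 4)"]
      pow_group_exponent[OF x(1)] subgroup.one_closed[OF H(1)] x(1) by simp
  have "?e mod 4 = 0"
  proof (rule ccontr)
    assume "?e mod 4 \<noteq> 0"
    then have "?e mod 4 \<in> {1, 2, 3}" by auto
    then consider "x [^] (1::nat) \<in> H" | "x [^] (2::nat) \<in> H" | "x [^] (3::nat) \<in> H" using r by auto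
    then show False
    proof cases
      case 3
      have "x [^] (4::nat) = x [^] (3::nat) \<otimes> x" by (simp add: numeral_eq_Suc)
      then have "x \<in> H" using x4 subgroup_mult_mem_iff(1)[OF H(1) 3 x(1)] by simp
      then show False using xH by simp
    qed (use x xH nat_pow_numeral_simps(1)[OF x(1)] in auto)
  qed
  then show ?thesis by (simp add: mod_eq_0_iff_dvd)
qed

text \<open>If all squares lay in the stabilizer \<open>?H\<close>, the two cosets
  \<open>?H #> a\<close> and \<open>?H #> b\<close> forming \<open>A\<close> would produce only
  \<open>?H\<close> and \<open>?H #> (a \<otimes> b)\<close>. That is at most half of the group,
  against the required three quarters.\<close>

lemma four_dvd_group_exponent_of_sumset:
  assumes A: "A \<subseteq> carrier G" "2 * card A = order G" "A <#> A \<noteq> carrier G"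
    and four: "order G = 4 * card (stabilizer_of A)"
  shows "4 dvd group_exponent G"
proof (rule ccontr)
  assume no: "\<not> 4 dvd group_exponent G"
  let ?H = "stabilizer_of A"
  note H = subgroup_stabilizer_of[OF A(1)]
  have HG: "?H \<subseteq> carrier G" using subgroup.subset[OF H] .
  have sq: "x \<otimes> x \<in> ?H" if "x \<in> carrier G" for x
    using four_dvd_group_exponent[OF H four that] no by blast
  have cA: "card A = 2 * card ?H" using A(2) four by simp
  have cH: "card ?H > 0" using four finite_carrier order_gt_0_iff_finite by auto
  have hA: "?H #> a \<subseteq> A" if "a \<in> A" for a
    unfolding r_coset_def using that unfolding stabilizer_of_def by auto
  obtain a where a: "a \<in> A" using cA cH by fastforce
  have aG: "a \<in> carrier G" using a A(1) by blast
  have "card (?H #> a) < card A" using card_r_coset[OF H aG] cA cH by simp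
  then have "?H #> a \<noteq> A" by auto
  then obtain b where b: "b \<in> A" "b \<notin> ?H #> a" using hA[OF a] by blast
  have bG: "b \<in> carrier G" using b A(1) by blast
  have "(?H #> a) \<inter> (?H #> b) = {}"
  proof (rule ccontr)
    assume "(?H #> a) \<inter> (?H #> b) \<noteq> {}"
    then obtain y where y: "y \<in> ?H #> a" "y \<in> ?H #> b" by blast
    then have "?H #> a = ?H #> b" using repr_independence[OF _ _ H] aG bG by metis
    then show False using b(2) rcos_self[OF bG H] by simp
  qed
  then have "card ((?H #> a) \<union> (?H #> b)) = card A"
    using card_Un_disjoint[of "?H #> a" "?H #> b"] card_r_coset[OF H] aG bG cA
      finite_subset_carrier r_coset_subset_G[OF HG] by simp
  then have Aeq: "(?H #> a) \<union> (?H #> b) = A"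
    using card_subset_eq[OF finite_subset_carrier[OF A(1)]] hA[OF a] hA[OF b(1)] by blast
  have prod: "(h \<otimes> x) \<otimes> (k \<otimes> y) \<in> ?H #> (x \<otimes> y)"
    if "h \<in> ?H" "k \<in> ?H" "x \<in> carrier G" "y \<in> carrier G" for h k x y
  proof -
    have "(h \<otimes> x) \<otimes> (k \<otimes> y) = (h \<otimes> k) \<otimes> (x \<otimes> y)" using that HG by (intro m_middle) auto
    then show ?thesis using subgroup.m_closed[OF H that(1,2)] unfolding r_coset_def by blast
  qed
  have self: "?H #> (x \<otimes> x) = ?H" if "x \<in> carrier G" for x
    using coset_join2[OF _ H sq[OF that]] that by simp
  have "A <#> A \<subseteq> ?H \<union> (?H #> (a \<otimes> b))"
  proof
    fix y assume "y \<in> A <#> A"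
    then obtain s t where st: "s \<in> A" "t \<in> A" "y = s \<otimes> t" by (rule set_multE)
    obtain h x where 1: "h \<in> ?H" "x \<in> {a, b}" "s = h \<otimes> x" using st(1) Aeq unfolding r_coset_def by blast
    obtain k z where 2: "k \<in> ?H" "z \<in> {a, b}" "t = k \<otimes> z" using st(2) Aeq unfolding r_coset_def by blast
    have "y \<in> ?H #> (x \<otimes> z)" using prod[OF 1(1) 2(1), of x z] 1 2 st(3) aG bG by auto
    then show "y \<in> ?H \<union> (?H #> (a \<otimes> b))"
      using 1(2) 2(2) self[OF aG] self[OF bG] m_comm[OF bG aG] by auto
  qed
  then have "card (A <#> A) \<le> card (?H \<union> (?H #> (a \<otimes> b)))"
    using HG r_coset_subset_G[OF HG, of "a \<otimes> b"] aG bG by (intro card_mono finite_subset_carrier) auto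
  also have "\<dots> \<le> 2 * card ?H" using card_Un_le[of ?H "?H #> (a \<otimes> b)"] card_r_coset[OF H, of "a \<otimes> b"] aG bG by simp
  finally show False using sumset_card_even[OF A] four cH by simp
qed

section \<open>Constructions in even order\<close>

text \<open>Write \<open>d = 2 * k\<close>. For \<open>k = 1\<close> the index-2 subgroup
  \<open>M\<close> itself works. For \<open>k \<ge> 3\<close>, trading \<open>H\<close> inside
  \<open>M\<close> for the outside coset \<open>H #> g\<close> leaves exactly that coset
  uncovered.\<close>

lemma even_realize:
  assumes d: "d dvd order G" "even d" "d \<noteq> 4"
  shows "\<exists>A \<subseteq> carrier G. 2 * card A = order G \<and> card (A <#> A) = order G - order G div d"
proof -
  have pos: "order G > 0" using finite_carrier order_gt_0_iff_finite by blast
  obtain k where k: "d = 2 * k" using d(2) by blast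
  let ?m = "order G div d"
  have m: "?m * d = order G" using d(1) by simp
  have mpos: "?m > 0" using m pos by (metis gr0I mult_0)
  have "card {\<one>} * ?m dvd order G" using m by (metis card.empty card.insert dvd_triv_left empty_iff finite.emptyI mult_1 One_nat_def)
  then obtain H where H: "subgroup H G" "card H = ?m"
    using ex_subgroup_card_between[OF triv_subgroup, of ?m] by auto
  have "card H * k dvd order G" using m k H(2) by (metis dvd_triv_left mult.assoc mult.commute)
  then obtain M where M: "subgroup M G" "H \<subseteq> M" "card M = ?m * k"
    using ex_subgroup_card_between[OF H(1)] H(2) by auto
  have cM: "2 * card M = order G" using M(3) m k by (metis mult.assoc mult.commute)
  have MG: "M \<subseteq> carrier G" using subgroup.subset[OF M(1)] .
  show ?thesis
  proof (cases "k = 1")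
    case True
    have "M <#> M = M" using subgroup_mult_id[OF M(1)] .
    moreover have "order G - ?m = card M" using M(3) True cM by simp
    ultimately show ?thesis using MG cM by auto
  next
    case False
    have "k \<noteq> 0" using k d(1) pos by auto
    then have k3: "k \<ge> 3" using False d(3) k by simp
    have "M \<noteq> carrier G" using cM pos by (auto simp: order_def)
    then obtain g where g: "g \<in> carrier G" "g \<notin> M" using MG by blast
    have gg: "g \<otimes> g \<in> M" by (rule square_mem_of_index_2[OF M(1) subgroup_self MG]) (use cM g in \<open>auto simp: order_def\<close>)
    have out: "x \<otimes> inv g \<in> M" if "x \<in> carrier G" "x \<notin> M" for x
      by (rule subgroup_mem_iff_of_index_2[OF M(1) subgroup_self MG]) (use cM g that in \<open>auto simp: order_def\<close>)
    have HG: "H \<subseteq> carrier G" using M(2) MG by blast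
    let ?C = "H #> g"
    have CG: "?C \<subseteq> carrier G" using r_coset_subset_G[OF HG g(1)] .
    have memC: "y \<in> ?C \<longleftrightarrow> y \<otimes> inv g \<in> H" if "y \<in> carrier G" for y
      using mem_r_coset_iff[OF H(1) g(1) that] .
    have CM: "?C \<inter> M = {}"
      unfolding r_coset_def using subgroup_mult_mem_iff(1)[OF M(1) _ g(1)] g(2) M(2) by auto
    define A where "A = (M - H) \<union> ?C"
    have AG: "A \<subseteq> carrier G" unfolding A_def using MG CG by blast
    have "card (M - H) = card M - card H" using M(2) finite_subset_carrier[OF HG] by (intro card_Diff_subset)
    moreover have "card H \<le> card M" using M(2) finite_subset_carrier[OF MG] by (intro card_mono)
    moreover have "card A = card (M - H) + card ?C" unfolding A_def
      using CM finite_subset_carrier[OF MG] finite_subset_carrier[OF CG] by (intro card_Un_disjoint) auto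
    ultimately have cA: "card A = card M" using card_r_coset[OF H(1) g(1)] by simp
    have "A <#> A = carrier G - ?C"
    proof
      show "A <#> A \<subseteq> carrier G - ?C"
      proof
        fix y assume "y \<in> A <#> A"
        then obtain s t where st: "s \<in> A" "t \<in> A" "y = s \<otimes> t" by (rule set_multE)
        have G: "s \<in> carrier G" "t \<in> carrier G" "y \<in> carrier G" using st AG by auto
        \<comment> \<open>Cancelling the coset of \<open>g\<close> would leave \<open>u\<close> in
          \<open>H\<close>, the part removed from \<open>M\<close>.\<close>
        have mixed: "u \<otimes> v \<notin> ?C" if u: "u \<in> M" "u \<notin> H" and v: "v \<in> ?C" for u v
        proof
          have uG: "u \<in> carrier G" "v \<in> carrier G" using u v MG CG by auto
          assume "u \<otimes> v \<in> ?C"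
          then have "(v \<otimes> inv g) \<otimes> u \<in> H" using memC[of "u \<otimes> v"] uG g(1) by (simp add: m_ac)
          moreover have "v \<otimes> inv g \<in> H" using memC v uG by simp
          ultimately show False using subgroup_mult_mem_iff(1)[OF H(1) _ uG(1)] u(2) by blast
        qed
        have CC: "u \<otimes> v \<in> M" if u: "u \<in> ?C" and v: "v \<in> ?C" for u v
        proof -
          obtain h h' where h: "h \<in> H" "u = h \<otimes> g" "h' \<in> H" "v = h' \<otimes> g" using u v unfolding r_coset_def by auto
          then have "u \<otimes> v = (h \<otimes> h') \<otimes> (g \<otimes> g)" using HG g(1) m_middle[of h g h' g] by auto
          moreover have "h \<otimes> h' \<in> M" using h M(2) subgroup.m_closed[OF M(1)] by blast
          ultimately show ?thesis using subgroup.m_closed[OF M(1) _ gg] by simp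
        qed
        consider "s \<in> M" "t \<in> M" | "s \<in> M" "s \<notin> H" "t \<in> ?C" | "t \<in> M" "t \<notin> H" "s \<in> ?C" | "s \<in> ?C" "t \<in> ?C"
          using st unfolding A_def by blast
        then have "y \<notin> ?C"
        proof cases
          case 1
          then show ?thesis using subgroup.m_closed[OF M(1)] st(3) CM by blast
        next
          case 2 then show ?thesis using mixed st(3) by blast
        next
          case 3 then show ?thesis using mixed[of t s] st(3) m_comm[OF G(1,2)] by simp
        next
          case 4 then show ?thesis using CC st(3) CM by blast
        qed
        then show "y \<in> carrier G - ?C" using G(3) by blast
      qed
      show "carrier G - ?C \<subseteq> A <#> A"
      proof
        fix z assume z: "z \<in> carrier G - ?C"
        show "z \<in> A <#> A"
        proof (cases "z \<in> M")
          case True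
          \<comment> \<open>Here \<open>k \<ge> 3\<close> enters: two cosets of \<open>H\<close> do
            not fill \<open>M\<close>, so some \<open>x\<close> makes both \<open>x\<close> and
            \<open>inv x \<otimes> z\<close> avoid \<open>H\<close>.\<close>
          have "card (H \<union> (H #> z)) \<le> 2 * ?m"
            using card_Un_le[of H "H #> z"] card_r_coset[OF H(1), of z] z H(2) by simp
          also have "\<dots> < card M" using M(3) k3 mpos by (simp add: mult.commute)
          finally have "\<not> M \<subseteq> H \<union> (H #> z)"
            using card_mono[of "H \<union> (H #> z)" M] finite_subset_carrier HG r_coset_subset_G[OF HG, of z] z
            by (auto simp: not_less[symmetric])
          then obtain x where x: "x \<in> M" "x \<notin> H" "x \<notin> H #> z" by blast
          have xG: "x \<in> carrier G" "z \<in> carrier G" using x z MG by auto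
          have "inv x \<otimes> z \<in> M" using subgroup.m_closed[OF M(1)] subgroup.m_inv_closed[OF M(1)] x(1) True by blast
          moreover have "inv x \<otimes> z \<notin> H"
          proof
            assume "inv x \<otimes> z \<in> H"
            then have "inv (inv x \<otimes> z) \<in> H" by (rule subgroup.m_inv_closed[OF H(1)])
            then have "x \<otimes> inv z \<in> H" using xG by (simp add: inv_mult)
            then show False using mem_r_coset_iff[OF H(1) xG(2,1)] x(3) by blast
          qed
          ultimately have "x \<otimes> (inv x \<otimes> z) \<in> A <#> A" using x by (intro set_multI) (auto simp: A_def)
          then show ?thesis using xG by simp
        next
          case False
          have "z \<otimes> inv g \<in> M" using out z False by blast
          moreover have "z \<otimes> inv g \<notin> H" using memC z by blast
          moreover have "g \<in> ?C" using rcos_self[OF g(1) H(1)] .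
          ultimately have "(z \<otimes> inv g) \<otimes> g \<in> A <#> A" by (intro set_multI) (auto simp: A_def)
          then show ?thesis using z g(1) by (simp add: m_assoc)
        qed
      qed
    qed
    then have "card (A <#> A) = order G - ?m"
      using card_Diff_subset[OF finite_subset_carrier[OF CG] CG] card_r_coset[OF H(1) g(1)] H(2) by (simp add: order_def)
    then show ?thesis using AG cA cM by auto
  qed
qed

section \<open>The subgroup of squares and the case of index 4\<close>

definition squares :: "'a set" where
  "squares = (\<lambda>x. x \<otimes> x) ` carrier G"

lemma subgroup_squares: "subgroup squares G"
proof (rule subgroupI)
  show "squares \<subseteq> carrier G" "squares \<noteq> {}" unfolding squares_def by auto
  fix a assume "a \<in> squares"
  then obtain x where x: "x \<in> carrier G" "a = x \<otimes> x" unfolding squares_def by blast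
  then have "inv a = inv x \<otimes> inv x" by (simp add: inv_mult)
  then show "inv a \<in> squares" using x unfolding squares_def by blast
  fix b assume "b \<in> squares"
  then obtain y where y: "y \<in> carrier G" "b = y \<otimes> y" unfolding squares_def by blast
  have "a \<otimes> b = (x \<otimes> y) \<otimes> (x \<otimes> y)" using x y m_middle by simp
  then show "a \<otimes> b \<in> squares" using x y unfolding squares_def by blast
qed

text \<open>Every element is annihilated by twice the order of the group of squares, so the
  exponent, and with it 4, divides that number.\<close>

lemma even_card_squares:
  assumes "4 dvd group_exponent G"
  shows "even (card squares)"
proof -
  let ?s = "card squares"
  have "x [^] (2 * ?s) = \<one>" if x: "x \<in> carrier G" for x
  proof -
    have "group (G\<lparr>carrier := squares\<rparr>)" using subgroup_imp_group[OF subgroup_squares] .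
    moreover have "x \<otimes> x \<in> squares" using x unfolding squares_def by blast
    ultimately have "(x \<otimes> x) [^] ?s = \<one>"
      using group.pow_order_eq_1[of "G\<lparr>carrier := squares\<rparr>" "x \<otimes> x"]
      by (simp add: order_def nat_pow_consistent[symmetric])
    then show ?thesis using x nat_pow_numeral_simps(1)[OF x] nat_pow_pow[OF x, of 2 ?s] by simp
  qed
  moreover have "squares \<noteq> {}" using subgroup.one_closed[OF subgroup_squares] by blast
  then have "0 < ?s" using subgroup.subset[OF subgroup_squares] finite_subset_carrier card_gt_0_iff by blast
  ultimately have "group_exponent G dvd 2 * ?s" by (intro group_exponent_dvd) auto
  then have "4 dvd 2 * ?s" using assms dvd_trans by blast
  then show ?thesis by presburger
qed

text \<open>\<open>H\<close> is maximal among the subgroups that contain an index-2 subgroup \<open>L\<close> of the squares and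
  avoid a square \<open>z = x \<otimes> x \<notin> L\<close>. Maximality puts every \<open>y\<close> with \<open>y \<otimes> y \<in> H\<close> into
  \<open>H \<union> Hz\<close>, and for every other \<open>y\<close> this applies to \<open>y \<otimes> inv x\<close>.\<close>

lemma ex_index_4_subgroup:
  assumes "4 dvd group_exponent G"
  shows "\<exists>H x. subgroup H G \<and> order G = 4 * card H \<and> x \<in> carrier G \<and> x \<otimes> x \<notin> H"
proof -
  let ?S = "squares"
  note S = subgroup_squares
  have SG: "?S \<subseteq> carrier G" using subgroup.subset[OF S] .
  \<comment> \<open>The group of squares is treated as a finite abelian group of its own, and a
    subgroup of half its order is carried back to \<open>G\<close>.\<close>
  obtain L where L: "subgroup L G" "L \<subseteq> ?S" "card ?S = 2 * card L"
  proof -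
    let ?G = "G\<lparr>carrier := ?S\<rparr>"
    have "comm_group ?G"
      using SG by (intro group.group_comm_groupI[OF subgroup_imp_group[OF S]]) (auto simp: m_comm subset_iff)
    then interpret S: finite_comm_group ?G
      using finite_subset_carrier[OF SG]
      by (simp add: finite_comm_group_def finite_comm_group_axioms_def)
    obtain k where k: "card ?S = 2 * k" using even_card_squares[OF assms] by blast
    have "card {\<one>\<^bsub>?G\<^esub>} * k dvd order ?G" using k by (simp add: order_def)
    then obtain L where "subgroup L ?G" "card L = k"
      using S.ex_subgroup_card_between[OF S.triv_subgroup, of k] by auto
    then show ?thesis using that[of L] incl_subgroup[OF S] k subgroup.subset[of L ?G] by auto
  qed
  have finS: "finite ?S" using SG finite_subset_carrier by blast
  have "?S \<noteq> {}" using subgroup.one_closed[OF S] by blast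
  then have "0 < card ?S" using finS by (simp add: card_gt_0_iff)
  then have "L \<noteq> ?S" using L(3) by auto
  then obtain z where z: "z \<in> ?S" "z \<notin> L" using L(2) by blast
  have zG: "z \<in> carrier G" using z SG by blast
  obtain x where x: "x \<in> carrier G" "z = x \<otimes> x" using z(1) unfolding squares_def by blast
  define F where "F = {H. subgroup H G \<and> L \<subseteq> H \<and> z \<notin> H}"
  have "F \<subseteq> Pow (carrier G)" unfolding F_def using subgroup.subset by blast
  then have "finite F" using finite_carrier by (meson finite_Pow_iff finite_subset)
  moreover have "L \<in> F" unfolding F_def using L(1) z(2) by blast
  ultimately obtain H where HF: "H \<in> F" and max: "\<And>J. J \<in> F \<Longrightarrow> H \<subseteq> J \<Longrightarrow> J = H"
    using finite_has_maximal[of F] by blast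
  have H: "subgroup H G" "L \<subseteq> H" "z \<notin> H" using HF unfolding F_def by auto
  have HG: "H \<subseteq> carrier G" using subgroup.subset[OF H(1)] .
  have step: "y \<in> H \<union> (H #> z)" if y: "y \<in> carrier G" "y \<otimes> y \<in> H" for y
  proof (cases "y \<in> H")
    case False
    let ?J = "H \<union> (H #> y)"
    have J: "subgroup ?J G" using subgroup_double[OF H(1) y False] by blast
    have "y \<in> ?J" using rcos_self[OF y(1) H(1)] by blast
    then have "?J \<noteq> H" using False by blast
    then have "?J \<notin> F" using max by blast
    then have "z \<in> ?J" using J H(2) unfolding F_def by blast
    then have "z \<otimes> inv y \<in> H" using mem_r_coset_iff[OF H(1) y(1) zG] H(3) by blast
    then have "inv (z \<otimes> inv y) \<in> H" by (rule subgroup.m_inv_closed[OF H(1)])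
    moreover have "inv (z \<otimes> inv y) = y \<otimes> inv z" using y(1) zG by (simp add: inv_mult m_comm)
    ultimately have "y \<in> H #> z" using mem_r_coset_iff[OF H(1) zG y(1)] by simp
    then show ?thesis by blast
  qed simp
  have zz: "z \<otimes> z \<in> H" using square_mem_of_index_2[OF L(1) S L(2,3) z(1)] H(2) by blast
  let ?M = "H \<union> (H #> z)"
  have M: "subgroup ?M G" "card ?M = 2 * card H" using subgroup_double[OF H(1) zG zz H(3)] by auto
  have MG: "?M \<subseteq> carrier G" using subgroup.subset[OF M(1)] .
  have xM: "x \<notin> ?M"
  proof
    assume "x \<in> ?M"
    then consider "x \<in> H" | "x \<otimes> inv z \<in> H" using mem_r_coset_iff[OF H(1) zG x(1)] by blast
    then show False
    proof cases
      case 1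
      then show False using subgroup.m_closed[OF H(1) 1 1] x(2) H(3) by simp
    next
      case 2
      \<comment> \<open>Because \<open>z\<close> is the square of \<open>x\<close>, membership in
        the second coset also puts \<open>x\<close> in \<open>H\<close>, and with it
        \<open>z\<close>.\<close>
      have "x \<otimes> inv z = inv x" using x by (simp add: inv_mult)
      then have "x \<in> H" using 2 subgroup_inv_mem_iff[OF H(1) x(1)] by simp
      then show False using subgroup.m_closed[OF H(1), of x x] x(2) H(3) by simp
    qed
  qed
  have cover: "y \<in> ?M \<union> (?M #> x)" if y: "y \<in> carrier G" for y
  proof (cases "y \<otimes> y \<in> H")
    case True
    then show ?thesis using step[OF y] by blast
  next
    case False
    then have "y \<otimes> y \<in> ?S" "y \<otimes> y \<notin> L" using y H(2) unfolding squares_def by auto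
    then have "(y \<otimes> y) \<otimes> inv z \<in> H"
      using subgroup_mem_iff_of_index_2[OF L(1) S L(2,3) z] H(2) by blast
    moreover have "(y \<otimes> inv x) \<otimes> (y \<otimes> inv x) = (y \<otimes> y) \<otimes> inv z"
      by (subst m_middle) (use x y in \<open>auto simp: inv_mult\<close>)
    ultimately have "y \<otimes> inv x \<in> ?M" using step[of "y \<otimes> inv x"] x y by simp
    then show ?thesis using mem_r_coset_iff[OF M(1) x(1) y] by blast
  qed
  have "?M \<inter> (?M #> x) = {}"
    using subgroup_mult_mem_iff(1)[OF M(1) _ x(1)] xM unfolding r_coset_def[of G ?M x] by auto
  then have "card (?M \<union> (?M #> x)) = 4 * card H"
    using card_Un_disjoint[of ?M "?M #> x"] card_r_coset[OF M(1) x(1)] M(2)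
      finite_subset_carrier[OF MG] finite_subset_carrier[OF r_coset_subset_G[OF MG x(1)]] by simp
  moreover have "?M \<union> (?M #> x) = carrier G" using cover MG r_coset_subset_G[OF MG x(1)] by blast
  ultimately have "order G = 4 * card H" by (simp add: order_def)
  then show ?thesis using H x by blast
qed

text \<open>Since \<open>x\<close> and its square lie outside \<open>H\<close>, the products of
  \<open>H \<union> (H #> x)\<close> fill exactly three distinct cosets out of four.\<close>

lemma even_realize_4:
  assumes "4 dvd group_exponent G"
  shows "\<exists>A \<subseteq> carrier G. 2 * card A = order G \<and> card (A <#> A) = order G - order G div 4"
proof -
  obtain H x where H: "subgroup H G" "order G = 4 * card H" and x: "x \<in> carrier G" "x \<otimes> x \<notin> H"
    using ex_index_4_subgroup[OF assms] by blast
  have HG: "H \<subseteq> carrier G" using subgroup.subset[OF H(1)] .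
  have xH: "x \<notin> H" using x subgroup.m_closed[OF H(1)] by blast
  let ?C = "H #> x" and ?D = "H #> (x \<otimes> x)"
  have G: "?C \<subseteq> carrier G" "?D \<subseteq> carrier G" using r_coset_subset_G[OF HG] x(1) by auto
  have "H \<inter> (H #> u) = {}" if "u \<in> carrier G" "u \<notin> H" for u
    using subgroup_mult_mem_iff(1)[OF H(1) _ that(1)] that(2) unfolding r_coset_def by auto
  then have d1: "H \<inter> ?C = {}" "H \<inter> ?D = {}" using x xH by simp_all
  have d2: "?C \<inter> ?D = {}"
  proof (rule ccontr)
    assume "?C \<inter> ?D \<noteq> {}"
    then obtain h k where hk: "h \<in> H" "k \<in> H" "h \<otimes> x = k \<otimes> (x \<otimes> x)" unfolding r_coset_def by auto
    have c: "h \<in> carrier G" "k \<in> carrier G" using hk HG by auto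
    have "h \<otimes> x = (k \<otimes> x) \<otimes> x" using hk(3) c x(1) by (simp add: m_assoc)
    then have "h = k \<otimes> x" using c x(1) by simp
    then have "k \<otimes> x \<in> H" using hk(1) by simp
    then show False using subgroup_mult_mem_iff(1)[OF H(1) hk(2) x(1)] xH by blast
  qed
  have fin: "finite H" "finite ?C" "finite ?D" using finite_subset_carrier HG G by auto
  have cc: "card ?C = card H" "card ?D = card H" using card_r_coset[OF H(1)] x(1) by auto
  let ?A = "H \<union> ?C"
  have cA: "card ?A = 2 * card H" using card_Un_disjoint[OF fin(1,2) d1(1)] cc by simp
  have prod: "(h \<otimes> u) \<otimes> (k \<otimes> v) \<in> H #> (u \<otimes> v)"
    if "h \<in> H" "k \<in> H" "u \<in> carrier G" "v \<in> carrier G" for h k u v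
  proof -
    have "(h \<otimes> u) \<otimes> (k \<otimes> v) = (h \<otimes> k) \<otimes> (u \<otimes> v)" using that HG by (intro m_middle) auto
    then show ?thesis using subgroup.m_closed[OF H(1) that(1,2)] unfolding r_coset_def by blast
  qed
  have H1: "H #> \<one> = H" using HG by simp
  have rep: "\<exists>h\<in>H. \<exists>u\<in>{\<one>, x}. s = h \<otimes> u" if s: "s \<in> ?A" for s
  proof (cases "s \<in> H")
    case True
    then have "s = s \<otimes> \<one>" using subsetD[OF HG True] by simp
    then show ?thesis using True by blast
  next
    case False
    then show ?thesis using s unfolding r_coset_def by blast
  qed
  have AA: "?A <#> ?A = H \<union> ?C \<union> ?D"
  proof
    show "?A <#> ?A \<subseteq> H \<union> ?C \<union> ?D"
    proof
      fix y assume "y \<in> ?A <#> ?A"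
      then obtain s t where st: "s \<in> ?A" "t \<in> ?A" "y = s \<otimes> t" by (rule set_multE)
      obtain h u where 1: "h \<in> H" "u \<in> {\<one>, x}" "s = h \<otimes> u"
        using rep[OF st(1)] by blast
      obtain k v where 2: "k \<in> H" "v \<in> {\<one>, x}" "t = k \<otimes> v"
        using rep[OF st(2)] by blast
      have uv: "u \<in> carrier G" "v \<in> carrier G" using 1(2) 2(2) x(1) by auto
      have y: "y \<in> H #> (u \<otimes> v)" using prod[OF 1(1) 2(1) uv] unfolding st(3) 1(3) 2(3) .
      have "u \<otimes> v = \<one> \<or> u \<otimes> v = x \<or> u \<otimes> v = x \<otimes> x" using 1(2) 2(2) x(1) by auto
      then have "H #> (u \<otimes> v) = H \<or> H #> (u \<otimes> v) = ?C \<or> H #> (u \<otimes> v) = ?D" using H1 by metis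
      then show "y \<in> H \<union> ?C \<union> ?D" using y by blast
    qed
    have one: "\<one> \<in> ?A" using subgroup.one_closed[OF H(1)] by blast
    have "y \<in> ?A <#> ?A" if "y \<in> ?A" for y
    proof -
      have "y \<in> carrier G" using that HG G(1) by blast
      then show ?thesis using set_multI[OF that one] by simp
    qed
    moreover have "y \<in> ?A <#> ?A" if y: "y \<in> ?D" for y
    proof -
      obtain h where h: "h \<in> H" "y = h \<otimes> (x \<otimes> x)" using y unfolding r_coset_def by auto
      have "h \<otimes> x \<in> ?C" unfolding r_coset_def using h(1) by blast
      then have "h \<otimes> x \<in> ?A" "x \<in> ?A" using rcos_self[OF x(1) H(1)] by simp_all
      then have "(h \<otimes> x) \<otimes> x \<in> ?A <#> ?A" by (rule set_multI)
      then show ?thesis using h(2) subsetD[OF HG h(1)] x(1) by (simp add: m_assoc)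
    qed
    ultimately show "H \<union> ?C \<union> ?D \<subseteq> ?A <#> ?A" by blast
  qed
  have "card (H \<union> ?C \<union> ?D) = 3 * card H"
    using card_Un_disjoint[of ?A ?D] fin d1(2) d2 cA cc by (simp add: Int_Un_distrib2)
  then have "card (?A <#> ?A) = order G - order G div 4" using H(2) unfolding AA by simp
  moreover have "?A \<subseteq> carrier G" using HG G(1) by blast
  moreover have "2 * card ?A = order G" using cA H(2) by simp
  ultimately show ?thesis by blast
qed

section \<open>Assembly for even order\<close>

lemma even_case:
  assumes even: "even (order G)" and n: "order G \<ge> 2"
  shows "Max {card A | A. incomplete G 2 A} = order G div 2"
    and "incomplete_sizes G 2 =
      {order G - order G div d | d. d dvd order G \<and> even d \<and> (d = 4 \<longrightarrow> 4 dvd group_exponent G)}"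
proof -
  let ?N = "order G div 2"
  have realize: "\<exists>A \<subseteq> carrier G. A <#> A \<noteq> carrier G \<and> card A = ?N \<and> card (A <#> A) = order G - order G div d"
    if d: "d dvd order G" "even d" "d = 4 \<longrightarrow> 4 dvd group_exponent G" for d
  proof -
    have "\<exists>A \<subseteq> carrier G. 2 * card A = order G \<and> card (A <#> A) = order G - order G div d"
    proof (cases "d = 4")
      case True
      then show ?thesis using even_realize_4 d(3) by simp
    next
      case False
      then show ?thesis using even_realize[OF d(1,2)] by simp
    qed
    then obtain A where A: "A \<subseteq> carrier G" "2 * card A = order G" "card (A <#> A) = order G - order G div d"
      by blast
    have "0 < d" using d(1) n by (cases d) auto
    \<comment> \<open>Positivity of the subtracted term is what makes the constructed set
      incomplete.\<close>
    then have "0 < order G div d" using d(1) n by (simp add: dvd_imp_le div_greater_zero_iff)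
    then have "card (A <#> A) < card (carrier G)" using A(3) n by (simp add: order_def)
    then have "A <#> A \<noteq> carrier G" by auto
    moreover have "card A = ?N" using A(2) by simp
    ultimately show ?thesis using A(1,3) by blast
  qed
  obtain B where B: "B \<subseteq> carrier G" "B <#> B \<noteq> carrier G" "card B = ?N"
    using realize[of 2] even by auto
  have le: "card A \<le> ?N" if "A \<subseteq> carrier G" "A <#> A \<noteq> carrier G" for A
    using card_incomplete[OF that] by simp
  have "1 \<le> ?N" using n by presburger
  note max = maximum_incomplete[OF this le B]
  show "Max {card A | A. incomplete G 2 A} = ?N" using max(1) by blast
  have "incomplete_sizes G 2 =
      {card (A <#> A) | A. A \<subseteq> carrier G \<and> A <#> A \<noteq> carrier G \<and> card A = ?N}"
    using max(2) by blast
  also have "\<dots> =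
      {order G - order G div d | d. d dvd order G \<and> even d \<and> (d = 4 \<longrightarrow> 4 dvd group_exponent G)}"
  proof (intro equalityI subsetI)
    fix s assume "s \<in> {card (A <#> A) | A. A \<subseteq> carrier G \<and> A <#> A \<noteq> carrier G \<and> card A = ?N}"
    then obtain A where A: "s = card (A <#> A)" "A \<subseteq> carrier G" "A <#> A \<noteq> carrier G" "card A = ?N"
      by blast
    have A2: "2 * card A = order G" using A(4) even by simp
    let ?H = "stabilizer_of A"
    note H = subgroup_stabilizer_of[OF A(2)]
    have "coset_union ?H A" unfolding coset_union_def stabilizer_of_def using A(2) by blast
    \<comment> \<open>\<open>A\<close> consists of \<open>j\<close> cosets of its stabilizer and is
      half of the group, so the index is \<open>2 * j\<close>; this is the divisor
      \<open>d\<close>.\<close>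
    then obtain j where j: "card A = card ?H * j" using coset_union_card_dvd[OF H] by blast
    have oG: "order G = card ?H * (2 * j)" using A2 j by simp
    have "0 < card ?H" using oG n by (cases "card ?H") auto
    moreover have "0 < j" using oG n by (cases j) auto
    ultimately have dv: "order G div (2 * j) = card ?H" using oG by simp
    have s: "s = order G - order G div (2 * j)" using sumset_card_even[OF A(2) A2 A(3)] A(1) dv by simp
    have "4 dvd group_exponent G" if "2 * j = 4"
      using four_dvd_group_exponent_of_sumset[OF A(2) A2 A(3)] oG that by simp
    moreover have "2 * j dvd order G" using oG by (metis dvd_triv_right)
    ultimately show "s \<in> {order G - order G div d | d. d dvd order G \<and> even d \<and> (d = 4 \<longrightarrow> 4 dvd group_exponent G)}"
      using s by (intro CollectI exI[of _ "2 * j"]) simp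
  next
    fix s assume "s \<in> {order G - order G div d | d. d dvd order G \<and> even d \<and> (d = 4 \<longrightarrow> 4 dvd group_exponent G)}"
    then obtain d where d: "s = order G - order G div d" "d dvd order G" "even d" "d = 4 \<longrightarrow> 4 dvd group_exponent G"
      by blast
    show "s \<in> {card (A <#> A) | A. A \<subseteq> carrier G \<and> A <#> A \<noteq> carrier G \<and> card A = ?N}"
    proof -
      obtain A where "A \<subseteq> carrier G" "A <#> A \<noteq> carrier G" "card A = ?N" "s = card (A <#> A)"
        using realize[OF d(2-4)] d(1) by metis
      then show ?thesis by blast
    qed
  qed
  finally show "incomplete_sizes G 2 =
      {order G - order G div d | d. d dvd order G \<and> even d \<and> (d = 4 \<longrightarrow> 4 dvd group_exponent G)}" .
qed

end

text \<open>Distinct divisors give distinct sizes, so the size for \<open>d = 4\<close> cannot arise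
  from another divisor.\<close>

lemma minus_div_inject:
  fixes n :: nat
  assumes "n > 0" "d dvd n" "e dvd n" "n - n div d = n - n div e"
  shows "d = e"
proof -
  have "n div d = n div e" using assms(4) div_le_dividend[of n d] div_le_dividend[of n e] by linarith
  then have "d * (n div d) = e * (n div d)"
    using dvd_mult_div_cancel[OF assms(2)] dvd_mult_div_cancel[OF assms(3)] by simp
  moreover have "n div d \<noteq> 0" using assms(1,2) by (auto simp: dvd_div_eq_0_iff)
  ultimately show ?thesis by simp
qed

theorem theorem1p1:
  fixes G :: "('a, 'b) monoid_scheme" and n :: nat
  assumes "comm_group G" and "finite (carrier G)" and "order G = n" and "n \<ge> 2"
  shows
    "(even n \<longrightarrow>
        Max {card A | A. incomplete G 2 A} = n div 2 \<and>
        incomplete_sizes G 2 \<subseteq> {n - n div d | d. d dvd n \<and> 2 dvd d} \<and>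
        (\<forall>d. d dvd n \<and> 2 dvd d \<longrightarrow>
           (n - n div d \<in> incomplete_sizes G 2 \<longleftrightarrow> (d = 4 \<longrightarrow> 4 dvd group_exponent G))) \<and>
        (4 dvd group_exponent G \<longrightarrow>
           incomplete_sizes G 2 = {n - n div d | d. d dvd n \<and> 2 dvd d}) \<and>
        (2 dvd group_exponent G \<and> \<not> 4 dvd group_exponent G \<longrightarrow>
           incomplete_sizes G 2 = {n - n div d | d. d dvd n \<and> 2 dvd d \<and> d \<noteq> 4})) \<and>
     (odd n \<longrightarrow>
        Max {card A | A. incomplete G 2 A} = (n - 1) div 2 \<and>
        (n = 3 \<or> n = 5 \<or> (n = 9 \<and> \<not> cyclic_group G) \<longrightarrow>
           incomplete_sizes G 2 = {n - 2}) \<and>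
        (\<not> (n = 3 \<or> n = 5 \<or> (n = 9 \<and> \<not> cyclic_group G)) \<longrightarrow>
           incomplete_sizes G 2 = {n - 2, n - 1}))"
proof -
  interpret finite_comm_group G
    using assms(1,2) by (simp add: finite_comm_group_def finite_comm_group_axioms_def)
  show ?thesis
  proof (cases "even n")
    case True
    note max = even_case(1)[unfolded assms(3), OF True assms(4)]
    note sizes = even_case(2)[unfolded assms(3), OF True assms(4)]
    have mem: "n - n div d \<in> incomplete_sizes G 2 \<longleftrightarrow> (d = 4 \<longrightarrow> 4 dvd group_exponent G)"
      if "d dvd n" "even d" for d
      using minus_div_inject[of n] that assms(4) unfolding sizes by auto
    have sub: "incomplete_sizes G 2 \<subseteq> {n - n div d | d. d dvd n \<and> even d}" unfolding sizes by blast
    have "incomplete_sizes G 2 = {n - n div d | d. d dvd n \<and> even d}" if "4 dvd group_exponent G"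
      using that unfolding sizes by simp
    moreover have "incomplete_sizes G 2 = {n - n div d | d. d dvd n \<and> even d \<and> d \<noteq> 4}"
      if "\<not> 4 dvd group_exponent G"
      using that unfolding sizes by simp
    ultimately show ?thesis using True max mem sub by blast
  next
    case False
    have "order G \<ge> 2" "odd (order G)" using assms False by auto
    from odd_case[OF this(2,1)] show ?thesis using False unfolding assms(3) by simp
  qed
qed

end
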